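(* Let the ground truth $\lambda^\dagger=\sum_{i=1}^Nm_i\delta_{(x_i,v_i)}\in\mathcal M_+(\Lambda)$ be random such that its location vector $((x_i,v_i))_{i=1}^N\in(\mathbb R^d\times\mathbb R^d)^N$ is distributed according to a probability distribution that is absolutely continuous with respect to the $2Nd$-dimensional Lebesgue measure. Let $\mathcal H_\Theta$ be the (normalized) counting measure on a set $\Theta\subset S^{d-1}$ of $d+1$ directions, any $d$ of which are linearly independent. Set $u_t^\dagger=\mathrm{Mv}^d_t\lambda^\dagger$, $\gamma_\theta^\dagger=\mathrm{Rj}_\theta\lambda^\dagger$, $f_t^\dagger=\mathrm{Ob}_tu_t^\dagger$. If there are three times $t\in\mathcal T$ at which $u_t^\dagger$ is the unique solution of $$\min_{u\in\mathcal M_+(\Omega)}\|u\|_{\mathcal M}\quad\text{s.t. }\mathrm{Ob}_tu=f_t^\dagger,$$ then almost surely the solution $(u,\gamma)$ of $$\min_{\gamma\in\mathcal M_+(\Theta\times\Gamma),\ u\in\mathcal M_+(\Omega)^\Sigma}\|\gamma\|_{\mathcal M}\quad\text{s.t. }\ \mathrm{Ob}_tu_t=f_t^\dagger\ \ \forall t\in\mathcal T,\qquad \mathrm{Mv}^1_t\gamma_\theta=\mathrm{Rd}_\theta u_t\ \ \text{for all }t\in\Sigma\text{ and }\mathcal H_\Theta\text{-a.a. }\theta\in\Theta$$ satisfies $u_t=u_t^\dagger$ for all $t\in\Sigma$, and $\gamma_\theta=\gamma_\theta^\dagger$ for $\mathcal H_\Theta$-almost all $\theta\in\Theta$.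
   Context: $\mathcal M(X)$ and $\mathcal M_+(X)$ denote the finite signed and the finite nonnegative Radon measures on $X$, $\|\cdot\|_{\mathcal M}$ the total variation norm, $g_\#\nu$ the pushforward of $\nu$ under $g$. $d\in\mathbb N$; $\Omega\subset\mathbb R^d$ and $\Sigma\subset\mathbb R$ are compact; $\emptyset\ne\mathcal T\subset\Sigma$ is finite. $\Lambda=\{(x,v)\in\mathbb R^d\times\mathbb R^d: x+tv\in\Omega\ \forall t\in\Sigma\}$ and $\Gamma=\{(\theta\cdot x,\theta\cdot v):(x,v)\in\Lambda,\theta\in\Theta\}\subset\mathbb R^2$; both are compact. Masses satisfy $m_i\ge0$. Operators: $\mathrm{Rd}_\theta\nu=[x\mapsto\theta\cdot x]_\#\nu$ for $\nu\in\mathcal M(\mathbb R^d)$; $\mathrm{Rj}_\theta\lambda=[(x,v)\mapsto(\theta\cdot x,\theta\cdot v)]_\#\lambda$ for $\lambda\in\mathcal M(\mathbb R^d\times\mathbb R^d)$; $\mathrm{Mv}^n_t\lambda=[(x,v)\mapsto x+tv]_\#\lambda$ for $\lambda\in\mathcal M(\mathbb R^n\times\mathbb R^n)$. $H$ is a Hilbert space and, for $t\in\mathcal T$, $\mathrm{Ob}_t:\mathcal M(\Omega)\to H$ is the dual of a bounded linear operator $\mathrm{Ob}_t^*:H\to C(\Omega)$. The slices $\gamma_\theta\in\mathcal M_+(\Gamma)$ are defined by the disintegration $\gamma=\mathcal H_\Theta\otimes_\theta\gamma_\theta$, i.e. $\gamma(A\times B)=\int_A\gamma_\theta(B)\,\mathrm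 d\mathcal H_\Theta(\theta)$; the constraint includes the existence of this disintegration. $\mathcal M_+(\Omega)^\Sigma$ is the set of families $(u_t)_{t\in\Sigma}$ with $u_t\in\mathcal M_+(\Omega)$.
   Formalization: For d≥3 and uncountable Σ, "almost surely u_t=u_t† for all t∈Σ" is false (ghost points at random times). Proved instead: a.s. for all t in any countable subset of Σ, and for all t∈Σ but finitely many; for d≤2 or countable Σ as stated. The γ_θ claim is unchanged. *)

theory Defs
  imports "HOL-Probability.Probability_Measure"
begin

text \<open>
  On the spaces used here (Borel subsets of Euclidean spaces) every finite Borel measure is Radon.
  A measure on \<open>X\<close> is represented by a Borel measure on the surrounding Euclidean space that is
  concentrated on \<open>X\<close>. Nonnegative measures use the type \<open>'a measure\<close>; signed measures are
  countably additive real set functions, extended by 0 to the non-Borel sets. A nonnegative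
  finite measure \<open>\<mu>\<close>, read as a signed one, is then just the set function \<open>measure \<mu>\<close>.
\<close>

definition nonneg_measures :: "'a::topological_space set \<Rightarrow> 'a measure set" where
  "nonneg_measures X = {\<mu>. sets \<mu> = sets borel \<and> finite_measure \<mu> \<and> emeasure \<mu> (- X) = 0}"

definition signed_measures :: "'a::topological_space set \<Rightarrow> ('a set \<Rightarrow> real) set" where
  "signed_measures X = {\<nu>.
     (\<forall>A. A \<notin> sets borel \<longrightarrow> \<nu> A = 0) \<and>
     (\<forall>A :: nat \<Rightarrow> 'a set. range A \<subseteq> sets borel \<longrightarrow> disjoint_family A \<longrightarrow>
        (\<lambda>i. \<nu> (A i)) sums \<nu> (\<Union>i. A i)) \<and>
     (\<forall>A\<in>sets borel. A \<inter> X = {} \<longrightarrow> \<nu> A = 0)}"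

definition tv_norm :: "('a::topological_space set \<Rightarrow> real) \<Rightarrow> real" where
  "tv_norm \<nu> = (SUP P\<in>{P. finite P \<and> P \<subseteq> sets borel \<and> partition_on UNIV P}. \<Sum>A\<in>P. \<bar>\<nu> A\<bar>)"

text \<open>
  The positive part in the Jordan decomposition; \<open>ennreal\<close> cuts negative values off at 0, which
  does not change the supremum because \<open>B = {}\<close> is admissible. The negative part of \<open>\<nu>\<close> is the
  positive part of \<open>- \<nu>\<close>.
\<close>

definition pos_part :: "('a::topological_space set \<Rightarrow> real) \<Rightarrow> 'a measure" where
  "pos_part \<nu> = measure_of UNIV (sets borel) (\<lambda>A. SUP B\<in>{B \<in> sets borel. B \<subseteq> A}. ennreal (\<nu> B))"

definition signed_integral ::
    "'a::topological_space set \<Rightarrow> ('a set \<Rightarrow> real) \<Rightarrow> ('a \<Rightarrow> real) \<Rightarrow> real" where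
  "signed_integral X \<nu> f =
     set_lebesgue_integral (pos_part \<nu>) X f - set_lebesgue_integral (pos_part (\<lambda>A. - \<nu> A)) X f"

definition bounded_linear_into_C ::
    "'a::topological_space set \<Rightarrow> ('h::real_normed_vector \<Rightarrow> 'a \<Rightarrow> real) \<Rightarrow> bool" where
  "bounded_linear_into_C X B \<longleftrightarrow>
     (\<forall>h. continuous_on X (B h)) \<and>
     (\<forall>h k. \<forall>x\<in>X. B (h + k) x = B h x + B k x) \<and>
     (\<forall>c h. \<forall>x\<in>X. B (c *\<^sub>R h) x = c * B h x) \<and>
     (\<exists>K. \<forall>h. \<forall>x\<in>X. \<bar>B h x\<bar> \<le> K * norm h)"

text \<open>
  \<open>Ob\<close> is the dual of \<open>B\<close>, a map from the signed measures on \<open>X\<close> to the Hilbert space that is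
  identified with its own dual.
\<close>

definition is_dual_of ::
    "'a::topological_space set \<Rightarrow> (('a set \<Rightarrow> real) \<Rightarrow> 'h::real_inner) \<Rightarrow> ('h \<Rightarrow> 'a \<Rightarrow> real) \<Rightarrow> bool" where
  "is_dual_of X Ob B \<longleftrightarrow>
     (\<forall>\<nu>\<in>signed_measures X. \<forall>h. inner (Ob \<nu>) h = signed_integral X \<nu> (B h))"

definition Rd :: "'a::euclidean_space \<Rightarrow> 'a measure \<Rightarrow> real measure" where
  "Rd \<theta> \<nu> = distr \<nu> borel (\<lambda>x. \<theta> \<bullet> x)"

definition Rj :: "'a::euclidean_space \<Rightarrow> ('a \<times> 'a) measure \<Rightarrow> (real \<times> real) measure" where
  "Rj \<theta> \<mu> = distr \<mu> borel (\<lambda>(x, v). (\<theta> \<bullet> x, \<theta> \<bullet> v))"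

text \<open>Used both on the full phase space and, with \<open>'a = real\<close>, on the one-dimensional one.\<close>

definition Mv :: "real \<Rightarrow> ('a::euclidean_space \<times> 'a) measure \<Rightarrow> 'a measure" where
  "Mv t \<mu> = distr \<mu> borel (\<lambda>(x, v). x + t *\<^sub>R v)"

definition Lambda_set :: "'a::euclidean_space set \<Rightarrow> real set \<Rightarrow> ('a \<times> 'a) set" where
  "Lambda_set \<Omega> \<Sigma> = {(x, v). \<forall>t\<in>\<Sigma>. x + t *\<^sub>R v \<in> \<Omega>}"

definition Gamma_set ::
    "'a::euclidean_space set \<Rightarrow> 'a set \<Rightarrow> real set \<Rightarrow> (real \<times> real) set" where
  "Gamma_set \<Theta> \<Omega> \<Sigma> = {(\<theta> \<bullet> x, \<theta> \<bullet> v) | \<theta> x v. \<theta> \<in> \<Theta> \<and> (x, v) \<in> Lambda_set \<Omega> \<Sigma>}"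

text \<open>The sum over \<open>i\<close> of \<open>m i\<close> times the Dirac measure at \<open>z $ i\<close>.\<close>

definition particles :: "('n::finite \<Rightarrow> real) \<Rightarrow> 'b::euclidean_space ^ 'n \<Rightarrow> 'b measure" where
  "particles m z = distr (point_measure UNIV (\<lambda>i. ennreal (m i))) borel (\<lambda>i. z $ i)"

text \<open>\<open>\<gamma>s\<close> are the slices of \<open>\<gamma>\<close> with respect to the normalized counting measure on \<open>\<Theta>\<close>.\<close>

definition is_disintegration ::
    "'a::euclidean_space set \<Rightarrow> (real \<times> real) set \<Rightarrow> ('a \<times> real \<times> real) measure \<Rightarrow>
     ('a \<Rightarrow> (real \<times> real) measure) \<Rightarrow> bool" where
  "is_disintegration \<Theta> \<Gamma> \<gamma> \<gamma>s \<longleftrightarrow>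
     (\<forall>\<theta>\<in>\<Theta>. \<gamma>s \<theta> \<in> nonneg_measures \<Gamma>) \<and>
     (\<forall>A\<in>sets borel. \<forall>B\<in>sets borel.
        emeasure \<gamma> (A \<times> B) =
          (\<integral>\<^sup>+\<theta>. indicator A \<theta> * emeasure (\<gamma>s \<theta>) B \<partial>uniform_count_measure \<Theta>))"

text \<open>The static problem at a single time, with observation operator \<open>Ob\<close> and data \<open>f\<close>.\<close>

definition static_solution ::
    "'a::euclidean_space set \<Rightarrow> (('a set \<Rightarrow> real) \<Rightarrow> 'h) \<Rightarrow> 'h \<Rightarrow> 'a measure \<Rightarrow> bool" where
  "static_solution \<Omega> Ob f =
     is_arg_min (\<lambda>u. tv_norm (measure u)) (\<lambda>u. u \<in> nonneg_measures \<Omega> \<and> Ob (measure u) = f)"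

definition unique_static_solution ::
    "'a::euclidean_space set \<Rightarrow> (('a set \<Rightarrow> real) \<Rightarrow> 'h) \<Rightarrow> 'h \<Rightarrow> 'a measure \<Rightarrow> bool" where
  "unique_static_solution \<Omega> Ob f u \<longleftrightarrow>
     static_solution \<Omega> Ob f u \<and> (\<forall>w. static_solution \<Omega> Ob f w \<longrightarrow> w = u)"

text \<open>The family \<open>u\<close> is a total function on the reals, of which only the values on \<open>\<Sigma>\<close> matter.\<close>

definition feasible ::
    "'a::euclidean_space set \<Rightarrow> real set \<Rightarrow> real set \<Rightarrow> 'a set \<Rightarrow>
     (real \<Rightarrow> ('a set \<Rightarrow> real) \<Rightarrow> 'h) \<Rightarrow> (real \<Rightarrow> 'h) \<Rightarrow>
     (real \<Rightarrow> 'a measure) \<times> ('a \<times> real \<times> real) measure \<Rightarrow> bool" where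
  "feasible \<Omega> \<Sigma> T \<Theta> Ob f = (\<lambda>(u, \<gamma>).
     (\<forall>t\<in>\<Sigma>. u t \<in> nonneg_measures \<Omega>) \<and>
     \<gamma> \<in> nonneg_measures (\<Theta> \<times> Gamma_set \<Theta> \<Omega> \<Sigma>) \<and>
     (\<forall>t\<in>T. Ob t (measure (u t)) = f t) \<and>
     (\<exists>\<gamma>s. is_disintegration \<Theta> (Gamma_set \<Theta> \<Omega> \<Sigma>) \<gamma> \<gamma>s \<and>
        (\<forall>t\<in>\<Sigma>. AE \<theta> in uniform_count_measure \<Theta>. Mv t (\<gamma>s \<theta>) = Rd \<theta> (u t))))"

definition dynamic_solution ::
    "'a::euclidean_space set \<Rightarrow> real set \<Rightarrow> real set \<Rightarrow> 'a set \<Rightarrow>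
     (real \<Rightarrow> ('a set \<Rightarrow> real) \<Rightarrow> 'h) \<Rightarrow> (real \<Rightarrow> 'h) \<Rightarrow>
     (real \<Rightarrow> 'a measure) \<Rightarrow> ('a \<times> real \<times> real) measure \<Rightarrow> bool" where
  "dynamic_solution \<Omega> \<Sigma> T \<Theta> Ob f u \<gamma> \<longleftrightarrow>
     is_arg_min (\<lambda>(u, \<gamma>). tv_norm (measure \<gamma>)) (feasible \<Omega> \<Sigma> T \<Theta> Ob f) (u, \<gamma>)"

end

theory Submission
  imports Defs "HOL-Analysis.Analysis"
begin

text \<open>
  The mass of a feasible \<open>\<gamma>\<close> equals the mass of every frame \<open>u t\<close>, so an optimal pair has an
  optimal static frame, hence the true one, at the three good times. Each slice of \<open>\<gamma>\<close> is a
  measure in the plane with three known projections along the directions \<open>(1, t)\<close>; each frame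
  \<open>u t\<close> in turn has known projections along \<open>d + 1\<close> directions. Both are instances of one
  problem: recovering a sum of point masses \<open>q i\<close> from \<open>d + 1\<close> projections in general position.
  The only linear relation between the directions turns every ghost point, where hyperplanes
  through different particles meet, into a nontrivial linear equation in the particles, the
  vanishing of a defect. For fixed \<open>t\<close> this has probability 0; along a trajectory it happens for
  finitely many \<open>t\<close>. In the plane, two essentially different defects never vanish at the same
  time, and a single ghost point is harmless, since each particle is still alone on one of its
  lines, from which its mass can be read off.
\<close>

section \<open>Negligible sets\<close>

lemma AE_lborel_negligible:
  fixes N :: "'a::euclidean_space set"
  assumes "negligible N"
  shows "AE x in lborel. x \<notin> N"
proof -
  have "AE x in lebesgue. x \<notin> N"
    using assms AE_not_in negligible_iff_null_sets by blast
  then show ?thesis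
    by (simp add: AE_completion_iff)
qed

lemma negligible_linear_zeros:
  fixes g :: "'a::euclidean_space \<Rightarrow> real"
  assumes "linear g" and "g a \<noteq> 0"
  shows "negligible {x. g x = 0}"
proof -
  define b where "b = adjoint g 1"
  have *: "g x = b \<bullet> x" for x
    using adjoint_works[OF assms(1), of x 1] by (simp add: b_def inner_commute)
  have "b \<noteq> 0"
    using assms(2) *[of a] by auto
  then show ?thesis
    unfolding * by (intro negligible_hyperplane) simp
qed

text \<open>
  Each orbit of the flow \<open>z + t V z\<close> meets the codimension two subspace \<open>\<alpha> = \<beta> = 0\<close> only
  exceptionally: the points that reach it are the image of the hyperplane \<open>\<beta> = 0\<close>, whose
  coordinate \<open>\<alpha>\<close> serves as the time parameter, under a differentiable map.
\<close>

lemma negligible_flow_into_codim2: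
  fixes V :: "'a::euclidean_space \<Rightarrow> 'a" and \<alpha> \<beta> :: "'a \<Rightarrow> real"
  assumes V: "linear V" "\<And>z. V (V z) = 0" and "linear \<alpha>" "linear \<beta>"
    and e: "V e = 0" "\<alpha> e = 1" "\<beta> e = 0" and g: "\<beta> g \<noteq> 0"
  shows "negligible {z. \<exists>t. \<alpha> (z + t *\<^sub>R V z) = 0 \<and> \<beta> (z + t *\<^sub>R V z) = 0}"
proof -
  interpret V: linear V by fact
  interpret \<alpha>: linear \<alpha> by fact
  interpret \<beta>: linear \<beta> by fact
  \<comment> \<open>\<open>h\<close> inverts the map from \<open>z\<close> to
    \<open>z + t V z + t e\<close>, where \<open>t\<close> is the time of arrival in the subspace:
    at the image \<open>\<alpha>\<close> equals \<open>t\<close>, and \<open>V\<close> takes the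
    same value as at \<open>z\<close>.\<close>
  define h where "h = (\<lambda>z. z - \<alpha> z *\<^sub>R (e + V z))"
  have neg: "negligible {z. \<beta> z = 0}"
    by (rule negligible_linear_zeros) fact+
  have "h differentiable_on {z. \<beta> z = 0}"
    unfolding h_def
    by (intro differentiable_on_diff differentiable_on_scaleR differentiable_on_add differentiable_on_id
        differentiable_on_const linear_imp_differentiable_on) (auto simp: V(1) \<open>linear \<alpha>\<close> linear_id[unfolded id_def])
  from negligible_differentiable_image_negligible[OF order_refl neg this]
  have "negligible (h ` {z. \<beta> z = 0})" .
  moreover have "{z. \<exists>t. \<alpha> (z + t *\<^sub>R V z) = 0 \<and> \<beta> (z + t *\<^sub>R V z) = 0} \<subseteq> h ` {z. \<beta> z = 0}"
  proof safe
    fix z t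
    assume t: "\<alpha> (z + t *\<^sub>R V z) = 0" "\<beta> (z + t *\<^sub>R V z) = 0"
    define x where "x = z + t *\<^sub>R V z + t *\<^sub>R e"
    have "\<alpha> x = t" "\<beta> x = 0" "V x = V z"
      using t e by (auto simp: x_def \<alpha>.add \<beta>.add \<alpha>.scaleR \<beta>.scaleR V.add V.scaleR V(2))
    then have "h x = z"
      by (simp add: h_def x_def algebra_simps)
    with \<open>\<beta> x = 0\<close> show "z \<in> h ` {z. \<beta> z = 0}"
      by force
  qed
  ultimately show ?thesis
    by (rule negligible_subset)
qed

section \<open>Tomography of point masses\<close>

text \<open>The projections confine \<mu> to the finite-valued grid of points that share each
  projection with some atom of \<nu>. By \<open>sep\<close> every atom is the only grid point on one
  of its hyperplanes, so its mass can be read off there. The direction may depend on the atom, and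
  other grid points are permitted.\<close>

lemma measure_eq_by_projections:
  fixes \<mu> \<nu> :: "'a::euclidean_space measure"
  assumes sets: "sets \<mu> = sets borel" "sets \<nu> = sets borel"
    and fin: "finite_measure \<mu>" "finite_measure \<nu>"
    and "finite A" and \<nu>A: "emeasure \<nu> (- A) = 0" and K: "finite K" "K \<noteq> {}"
    and proj: "\<And>k. k \<in> K \<Longrightarrow> distr \<mu> borel (\<lambda>y. k \<bullet> y) = distr \<nu> borel (\<lambda>y. k \<bullet> y)"
    and sep: "\<And>p. p \<in> A \<Longrightarrow>
      \<exists>k\<in>K. \<forall>y. (\<forall>j\<in>K. \<exists>a\<in>A. j \<bullet> y = j \<bullet> a) \<longrightarrow> k \<bullet> y = k \<bullet> p \<longrightarrow> y = p"
  shows "\<mu> = \<nu>"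
proof -
  note [measurable_cong] = sets
  have sp: "space \<mu> = UNIV" "space \<nu> = UNIV"
    using sets_eq_imp_space_eq[OF sets(1)] sets_eq_imp_space_eq[OF sets(2)] by simp_all
  have Ab: "A \<in> sets borel"
    using \<open>finite A\<close> by (simp add: finite_imp_closed borel_closed)
  have slab: "emeasure \<mu> {y. k \<bullet> y \<in> F} = emeasure \<nu> {y. k \<bullet> y \<in> F}"
    if "k \<in> K" "F \<in> sets borel" for k and F :: "real set"
  proof -
    have "emeasure (distr \<mu> borel (\<lambda>y. k \<bullet> y)) F = emeasure (distr \<nu> borel (\<lambda>y. k \<bullet> y)) F"
      using proj[OF \<open>k \<in> K\<close>] by simp
    then show ?thesis
      using that by (simp add: emeasure_distr sp vimage_def)
  qed
  have tot: "emeasure \<mu> UNIV = emeasure \<nu> UNIV"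
    using K(2) slab[of _ UNIV] by auto
  have "AE y in \<nu>. y \<in> A"
    using \<nu>A Ab by (intro AE_I[of _ _ "- A"]) (auto simp: sets)
  then have \<nu>grid: "AE y in \<nu>. \<forall>j\<in>K. \<exists>a\<in>A. j \<bullet> y = j \<bullet> a"
    by eventually_elim auto
  have \<mu>grid: "AE y in \<mu>. \<forall>j\<in>K. \<exists>a\<in>A. j \<bullet> y = j \<bullet> a"
  proof (rule AE_finite_allI[OF K(1)])
    fix k assume "k \<in> K"
    have F: "- ((\<bullet>) k ` A) \<in> sets borel"
      using \<open>finite A\<close> by (simp add: finite_imp_closed borel_closed borel_comp)
    have "emeasure \<mu> {y. k \<bullet> y \<in> - ((\<bullet>) k ` A)} = emeasure \<nu> {y. k \<bullet> y \<in> - ((\<bullet>) k ` A)}"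
      by (rule slab) fact+
    also have "\<dots> \<le> emeasure \<nu> (- A)"
      using Ab by (intro emeasure_mono) (auto simp: sets)
    finally have "emeasure \<mu> {y. k \<bullet> y \<in> - ((\<bullet>) k ` A)} = 0"
      using \<nu>A by simp
    moreover have "{y. k \<bullet> y \<in> - ((\<bullet>) k ` A)} \<in> sets \<mu>"
      using measurable_sets[OF _ F, of "\<lambda>y. k \<bullet> y" borel] by (simp add: vimage_def sets)
    ultimately show "AE y in \<mu>. \<exists>a\<in>A. k \<bullet> y = k \<bullet> a"
      by (intro AE_I[of _ _ "{y. k \<bullet> y \<in> - ((\<bullet>) k ` A)}"]) auto
  qed
  have single: "emeasure \<mu> {p} = emeasure \<nu> {p}" if p: "p \<in> A" for p
  proof -
    obtain k where k: "k \<in> K"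
      and uniq: "\<And>y. (\<forall>j\<in>K. \<exists>a\<in>A. j \<bullet> y = j \<bullet> a) \<Longrightarrow> k \<bullet> y = k \<bullet> p \<Longrightarrow> y = p"
      using sep[OF p] by blast
    have meas: "{y. k \<bullet> y \<in> {k \<bullet> p}} \<in> sets borel"
      using measurable_sets[of "\<lambda>y. k \<bullet> y" borel borel "{k \<bullet> p}"] by (simp add: vimage_def)
    have "emeasure \<mu> {p} = emeasure \<mu> {y. k \<bullet> y \<in> {k \<bullet> p}}"
      \<comment> \<open>Up to a null set the hyperplane consists of \<open>p\<close> alone.\<close>
      using \<mu>grid uniq p by (intro emeasure_eq_AE AE_mp[OF \<mu>grid AE_I2]) (auto simp: sets meas)
    also have "\<dots> = emeasure \<nu> {y. k \<bullet> y \<in> {k \<bullet> p}}"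
      by (rule slab) (use k in auto)
    also have "\<dots> = emeasure \<nu> {p}"
      using \<nu>grid uniq p by (intro emeasure_eq_AE AE_mp[OF \<nu>grid AE_I2]) (auto simp: sets meas)
    finally show ?thesis .
  qed
  have sub: "emeasure \<mu> B = emeasure \<nu> B" if "B \<subseteq> A" for B
  proof -
    have "finite B"
      using \<open>finite A\<close> that finite_subset by blast
    then show ?thesis
      using that single by (subst (1 2) emeasure_eq_sum_singleton) (auto simp: sets intro!: sum.cong)
  qed
  \<comment> \<open>The remaining grid points are not treated one by one: \<open>A\<close> already
    exhausts the total mass, which both measures share.\<close>
  have "emeasure \<mu> (- A) = emeasure \<nu> (- A)"
    using emeasure_compl[of A \<mu>] emeasure_compl[of A \<nu>] Ab finite_measure.emeasure_finite[OF fin(1)]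
      finite_measure.emeasure_finite[OF fin(2)] sub[of A] tot
    by (simp add: sets sp Compl_eq_Diff_UNIV)
  then have "AE y in \<mu>. y \<in> A"
    using \<nu>A Ab by (intro AE_I[of _ _ "- A"]) (auto simp: sets)
  show ?thesis
  proof (rule measure_eqI)
    fix B assume "B \<in> sets \<mu>"
    then have B: "B \<in> sets borel" by (simp add: sets)
    have "emeasure \<mu> B = emeasure \<mu> (B \<inter> A)"
      using \<open>AE y in \<mu>. y \<in> A\<close> B Ab by (intro emeasure_eq_AE) (auto simp: sets)
    also have "\<dots> = emeasure \<nu> (B \<inter> A)"
      by (rule sub) auto
    also have "\<dots> = emeasure \<nu> B"
      using \<open>AE y in \<nu>. y \<in> A\<close> B Ab by (intro emeasure_eq_AE) (auto simp: sets)
    finally show "emeasure \<mu> B = emeasure \<nu> B" .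
  qed (simp add: sets)
qed

text \<open>The directions are not normalized, because the locale is used twice: for \<Theta>
  itself, and for the vectors \<open>(1, t)\<close> in the phase plane with \<open>t\<close> from
  three times.\<close>

locale general_position =
  fixes \<Theta> :: "'a::euclidean_space set"
  assumes finite_dirs: "finite \<Theta>" and card_dirs: "card \<Theta> = DIM('a) + 1"
    and indep: "\<And>K. K \<subseteq> \<Theta> \<Longrightarrow> card K = DIM('a) \<Longrightarrow> independent K"
begin

section \<open>Linear algebra of \<open>d + 1\<close> directions in general position\<close>

lemma dirs_ne: "\<Theta> \<noteq> {}"
  using card_dirs by auto

lemma proper_independent:
  assumes "K \<subset> \<Theta>"
  shows "independent K"
proof -
  obtain k where k: "k \<in> \<Theta>" "k \<notin> K"
    using assms by blast
  have "independent (\<Theta> - {k})"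
    using k card_dirs by (intro indep) auto
  moreover have "K \<subseteq> \<Theta> - {k}"
    using assms k by auto
  ultimately show ?thesis
    by (rule independent_mono)
qed

lemma eq_by_projections:
  assumes K: "K \<subseteq> \<Theta>" "card K = DIM('a)" and eq: "\<And>k. k \<in> K \<Longrightarrow> k \<bullet> y = k \<bullet> p"
  shows "y = p"
proof -
  have "finite K"
    using K finite_dirs finite_subset by blast
  then have sp: "y - p \<in> span K"
    using indep[OF K] K(2) card_eq_dim[of K UNIV] by auto
  have "orthogonal (y - p) k" if "k \<in> K" for k
    using eq[OF that] by (simp add: orthogonal_def inner_diff_left inner_commute[of y] inner_commute[of p])
  then have "orthogonal (y - p) (y - p)"
    using orthogonal_to_span[OF sp] by blast
  then show ?thesis
    by (simp add: orthogonal_self)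
qed

text \<open>There is one vector too many for independence, while every proper subset is independent.
  Hence all coefficients of a relation are nonzero, and a vanishing proper partial sum would be a
  second relation. The partial sums matter because they are the gradients of defects in single
  particles.\<close>

lemma ex_relation:
  "\<exists>c. (\<Sum>k\<in>\<Theta>. c k *\<^sub>R k) = 0 \<and> (\<forall>K. K \<subset> \<Theta> \<longrightarrow> K \<noteq> {} \<longrightarrow> (\<Sum>k\<in>K. c k *\<^sub>R k) \<noteq> 0)"
proof -
  have "dependent \<Theta>"
    by (rule dependent_biggerset) (simp add: card_dirs)
  then obtain c k0 where c: "(\<Sum>k\<in>\<Theta>. c k *\<^sub>R k) = 0" and k0: "k0 \<in> \<Theta>" "c k0 \<noteq> 0"
    by (auto simp: dependent_finite[OF finite_dirs])
  have indep_zero: "\<forall>k\<in>K. c k = 0" if "K \<subset> \<Theta>" "(\<Sum>k\<in>K. c k *\<^sub>R k) = 0" for K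
    using proper_independent[OF that(1)] that(2) unfolding independent_explicit by blast
  have nz: "c k \<noteq> 0" if "k \<in> \<Theta>" for k
  proof
    assume "c k = 0"
    then have "(\<Sum>j\<in>\<Theta> - {k}. c j *\<^sub>R j) = 0"
      using c that by (simp add: sum_diff1 finite_dirs)
    then have "\<forall>j\<in>\<Theta> - {k}. c j = 0"
      using that by (intro indep_zero) auto
    then show False
      using k0 \<open>c k = 0\<close> by auto
  qed
  show ?thesis
  proof (intro exI[of _ c] conjI allI impI notI)
    fix K assume "K \<subset> \<Theta>" "K \<noteq> {}" "(\<Sum>k\<in>K. c k *\<^sub>R k) = 0"
    then show False
      using indep_zero[of K] nz by blast
  qed (rule c)
qed

text \<open>The relation is unique up to a nonzero factor, which does not affect the vanishing of
  defects, so any choice serves.\<close>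

definition coef :: "'a \<Rightarrow> real" where
  "coef = (SOME c. (\<Sum>k\<in>\<Theta>. c k *\<^sub>R k) = 0 \<and>
     (\<forall>K. K \<subset> \<Theta> \<longrightarrow> K \<noteq> {} \<longrightarrow> (\<Sum>k\<in>K. c k *\<^sub>R k) \<noteq> 0))"

lemma sum_coef: "(\<Sum>k\<in>\<Theta>. coef k *\<^sub>R k) = 0"
  and sum_coef_proper: "K \<subset> \<Theta> \<Longrightarrow> K \<noteq> {} \<Longrightarrow> (\<Sum>k\<in>K. coef k *\<^sub>R k) \<noteq> 0"
  using someI_ex[OF ex_relation] unfolding coef_def by blast+

text \<open>
  The hyperplanes through \<open>q (\<iota> k)\<close> orthogonal to \<open>k\<close>, for \<open>k\<in>\<Theta>\<close>, have a common point
  only if \<open>defect \<iota> q = 0\<close>.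
\<close>

definition defect :: "('a \<Rightarrow> 'n) \<Rightarrow> ('n \<Rightarrow> 'a) \<Rightarrow> real" where
  "defect \<iota> q = (\<Sum>k\<in>\<Theta>. coef k * (k \<bullet> q (\<iota> k)))"

text \<open>Constant assignments are left out because their hyperplanes always meet, in the particle
  itself. Extensional functions on \<Theta> keep the set finite.\<close>

definition mixed :: "('a \<Rightarrow> 'n) set" where
  "mixed = {\<iota> \<in> \<Theta> \<rightarrow>\<^sub>E UNIV. \<exists>k\<in>\<Theta>. \<exists>j\<in>\<Theta>. \<iota> k \<noteq> \<iota> j}"

definition regular :: "('n \<Rightarrow> 'a) \<Rightarrow> bool" where
  "regular q \<longleftrightarrow> (\<forall>\<iota>\<in>mixed. defect \<iota> q \<noteq> 0)"

text \<open>This is the separation hypothesis of \<open>measure_eq_by_projections\<close> for the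
  atoms \<open>q i\<close>. It is weaker than \<open>regular\<close>: ghost points may exist as long
  as each particle has one hyperplane that avoids them.\<close>

definition isolated :: "('n \<Rightarrow> 'a) \<Rightarrow> bool" where
  "isolated q \<longleftrightarrow> (\<forall>l. \<exists>k\<in>\<Theta>. \<forall>y.
     (\<forall>j\<in>\<Theta>. \<exists>i. j \<bullet> y = j \<bullet> q i) \<longrightarrow> k \<bullet> y = k \<bullet> q l \<longrightarrow> y = q l)"

section \<open>Defects and ghost points\<close>

lemma finite_mixed: "finite (mixed :: ('a \<Rightarrow> 'n::finite) set)"
proof (rule finite_subset)
  show "(mixed :: ('a \<Rightarrow> 'n) set) \<subseteq> \<Theta> \<rightarrow>\<^sub>E UNIV"
    by (auto simp: mixed_def)
qed (simp add: finite_PiE finite_dirs)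

lemma defect_add: "defect \<iota> (\<lambda>i. q i + r i) = defect \<iota> q + defect \<iota> r"
  by (simp add: defect_def algebra_simps sum.distrib)

lemma defect_scaleR: "defect \<iota> (\<lambda>i. a *\<^sub>R q i) = a * defect \<iota> q"
  by (simp add: defect_def sum_distrib_left algebra_simps)

lemma defect_eq_0:
  assumes "\<And>k. k \<in> \<Theta> \<Longrightarrow> k \<bullet> y = k \<bullet> q (\<iota> k)"
  shows "defect \<iota> q = 0"
proof -
  have "defect \<iota> q = (\<Sum>k\<in>\<Theta>. coef k *\<^sub>R k) \<bullet> y"
    by (simp add: defect_def inner_sum_left assms)
  then show ?thesis
    by (simp add: sum_coef)
qed

text \<open>Exhibits the gradient of the defect in the position of particle \<open>l\<close> as the
  partial sum of the linear relation over the directions assigned to \<open>l\<close>.\<close>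

lemma defect_single:
  "defect \<iota> (\<lambda>i. if i = l then s else 0) = (\<Sum>k\<in>{k\<in>\<Theta>. \<iota> k = l}. coef k *\<^sub>R k) \<bullet> s"
  unfolding defect_def inner_sum_left using finite_dirs
  by (simp add: sum.inter_filter if_distrib[of "\<lambda>x. _ * (_ \<bullet> x)"] cong: if_cong)

text \<open>Reads an assignment off a ghost point on a hyperplane through \<open>q l\<close>. It is
  mixed because a point that agrees with \<open>q l\<close> in \<open>d\<close> directions is
  \<open>q l\<close>.\<close>

lemma grid_index:
  assumes grid: "\<And>j. j \<in> \<Theta> \<Longrightarrow> \<exists>i. j \<bullet> y = j \<bullet> q i" and k: "k \<in> \<Theta>" "k \<bullet> y = k \<bullet> q l" and ne: "y \<noteq> q l"
  obtains \<iota> where "\<iota> \<in> mixed" "\<iota> k = l" "\<And>j. j \<in> \<Theta> \<Longrightarrow> j \<bullet> y = j \<bullet> q (\<iota> j)" "defect \<iota> q = 0"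
proof -
  obtain i where i: "\<And>j. j \<in> \<Theta> \<Longrightarrow> j \<bullet> y = j \<bullet> q (i j)"
    using grid by metis
  \<comment> \<open>The index chosen at \<open>k\<close> may belong to another particle on the same
    hyperplane; it is overridden by \<open>l\<close>.\<close>
  define \<iota> where "\<iota> = restrict (i(k := l)) \<Theta>"
  have \<iota>: "\<iota> k = l" "\<iota> \<in> \<Theta> \<rightarrow>\<^sub>E UNIV" "\<And>j. j \<in> \<Theta> \<Longrightarrow> j \<bullet> y = j \<bullet> q (\<iota> j)"
    using i k by (auto simp: \<iota>_def)
  have "\<exists>j\<in>\<Theta>. \<iota> j \<noteq> l"
  proof (rule ccontr)
    assume "\<not> (\<exists>j\<in>\<Theta>. \<iota> j \<noteq> l)"
    with \<iota>(3) have "\<And>j. j \<in> \<Theta> - {k} \<Longrightarrow> j \<bullet> y = j \<bullet> q l"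
      by auto
    then have "y = q l"
      using k card_dirs by (intro eq_by_projections[of "\<Theta> - {k}"]) auto
    with ne show False ..
  qed
  with \<iota> k have "\<iota> \<in> mixed"
    unfolding mixed_def by blast
  with \<iota> show ?thesis
    by (intro that) (auto intro!: defect_eq_0)
qed

text \<open>Regularity excludes ghost points altogether, so any direction separates.\<close>

lemma regular_imp_isolated:
  assumes "regular q"
  shows "isolated q"
  unfolding isolated_def
proof (intro allI)
  fix l
  obtain k where k: "k \<in> \<Theta>"
    using dirs_ne by blast
  have "y = q l" if "\<forall>j\<in>\<Theta>. \<exists>i. j \<bullet> y = j \<bullet> q i" "k \<bullet> y = k \<bullet> q l" for y
    using grid_index[of y q k l] that k assms unfolding regular_def by metis
  with k show "\<exists>k\<in>\<Theta>. \<forall>y. (\<forall>j\<in>\<Theta>. \<exists>i. j \<bullet> y = j \<bullet> q i) \<longrightarrow> k \<bullet> y = k \<bullet> q l \<longrightarrow> y = q l"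
    by blast
qed

text \<open>On a line a single direction already determines the point.\<close>

lemma isolated_linear:
  assumes "DIM('a) = 1"
  shows "isolated q"
  unfolding isolated_def
proof (intro allI)
  fix l
  obtain k where k: "k \<in> \<Theta>"
    using dirs_ne by blast
  have "y = q l" if "k \<bullet> y = k \<bullet> q l" for y
    using that k assms by (intro eq_by_projections[of "{k}"]) auto
  with k show "\<exists>k\<in>\<Theta>. \<forall>y. (\<forall>j\<in>\<Theta>. \<exists>i. j \<bullet> y = j \<bullet> q i) \<longrightarrow> k \<bullet> y = k \<bullet> q l \<longrightarrow> y = q l"
    by blast
qed

text \<open>Placing all particles but \<open>\<iota> k\<close> at the origin leaves the inner
  product with one gradient. As \<iota> is mixed, this gradient is a proper nonempty partial sum
  \<open>s\<close>, and particle \<open>\<iota> k\<close> placed at \<open>s\<close> gives defect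
  \<open>s \<bullet> s\<close>.\<close>

lemma ex_defect_nonzero:
  assumes "\<iota> \<in> mixed"
  shows "\<exists>q. defect \<iota> q \<noteq> 0"
proof -
  obtain k j where kj: "k \<in> \<Theta>" "j \<in> \<Theta>" "\<iota> k \<noteq> \<iota> j"
    using assms by (auto simp: mixed_def)
  define s where "s = (\<Sum>i\<in>{i\<in>\<Theta>. \<iota> i = \<iota> k}. coef i *\<^sub>R i)"
  have "s \<noteq> 0"
    unfolding s_def
  proof (rule sum_coef_proper)
    show "{i \<in> \<Theta>. \<iota> i = \<iota> k} \<subset> \<Theta>"
      using kj by force
  qed (use kj in auto)
  then have "defect \<iota> (\<lambda>i. if i = \<iota> k then s else 0) \<noteq> 0"
    unfolding defect_single s_def[symmetric] by simp
  then show ?thesis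
    by (rule exI[of "\<lambda>q. defect \<iota> q \<noteq> 0"])
qed

text \<open>Each of the finitely many mixed assignments excludes a hyperplane of configurations;
  surjectivity of \<open>Q\<close> lifts a configuration with nonzero defect to a suitable
  \<open>z\<close>. \<open>Q\<close> will be the position at a fixed time, the velocity, or the
  projection of a phase point to the phase plane.\<close>

lemma AE_regular:
  fixes Q :: "'b::euclidean_space \<Rightarrow> 'a"
  assumes "linear Q" "surj Q"
  shows "AE z in lborel. regular (\<lambda>i::'n::finite. Q (z $ i))"
  unfolding regular_def
proof (rule AE_finite_allI[OF finite_mixed])
  interpret Q: linear Q by fact
  fix \<iota> :: "'a \<Rightarrow> 'n" assume "\<iota> \<in> mixed"
  then obtain q where q: "defect \<iota> q \<noteq> 0"
    using ex_defect_nonzero by blast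
  have "negligible {z. defect \<iota> (\<lambda>i. Q (z $ i)) = 0}"
  proof (rule negligible_linear_zeros)
    show "linear (\<lambda>z. defect \<iota> (\<lambda>i. Q (z $ i)))"
      by (rule linearI) (simp_all add: Q.add Q.scaleR defect_add defect_scaleR)
    show "defect \<iota> (\<lambda>i. Q ((\<chi> i. inv Q (q i)) $ i)) \<noteq> 0"
      using q \<open>surj Q\<close> by (simp add: surj_f_inv_f)
  qed
  from AE_lborel_negligible[OF this]
  show "AE z in lborel. defect \<iota> (\<lambda>i. Q (z $ i)) \<noteq> 0"
    by simp
qed

text \<open>Along a trajectory a defect is affine in \<open>t\<close>, with slope
  \<open>defect \<iota> v\<close>. Regular velocities make all these slopes nonzero, so each defect
  has one root.\<close>

lemma finite_irregular_times:
  fixes x v :: "'n::finite \<Rightarrow> 'a"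
  assumes "regular v"
  shows "finite {t. \<not> regular (\<lambda>i. x i + t *\<^sub>R v i)}"
proof (rule finite_subset)
  show "{t. \<not> regular (\<lambda>i. x i + t *\<^sub>R v i)} \<subseteq> (\<lambda>\<iota>. - defect \<iota> x / defect \<iota> v) ` mixed"
  proof
    fix t assume "t \<in> {t. \<not> regular (\<lambda>i. x i + t *\<^sub>R v i)}"
    then obtain \<iota> where "\<iota> \<in> mixed" "defect \<iota> x + t * defect \<iota> v = 0"
      by (auto simp: regular_def defect_add defect_scaleR)
    moreover from this assms have "t = - defect \<iota> x / defect \<iota> v"
      by (auto simp: regular_def field_simps eq_neg_iff_add_eq_0)
    ultimately show "t \<in> (\<lambda>\<iota>. - defect \<iota> x / defect \<iota> v) ` mixed"
      by blast
  qed
qed (simp add: finite_mixed)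

text \<open>
  In the plane two different defects that involve the particle \<open>l\<close> through one direction each
  never vanish at the same time, so \<open>l\<close> is always alone on one of any two of its lines.
\<close>

lemma AE_planar_isolated:
  assumes d2: "DIM('a) = 2"
  shows "AE z in lborel. \<forall>t. isolated (\<lambda>i::'n::finite. fst (z $ i) + t *\<^sub>R snd (z $ i))"
proof -
  define q where "q t z i = fst (z $ i) + t *\<^sub>R snd (z $ i)" for t and z :: "('a \<times> 'a) ^ 'n" and i
  \<comment> \<open>Particle \<open>l\<close> enters the defect of such an \<iota> through direction
    \<open>k\<close> alone, with gradient \<open>coef k *\<^sub>R k\<close>. Gradients for different
    directions are linearly independent in the plane.\<close>
  define only where "only l k \<iota> \<longleftrightarrow> {j\<in>\<Theta>. \<iota> j = l} = {k}" for l :: 'n and k and \<iota> :: "'a \<Rightarrow> 'n"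
  have key: "AE z in lborel. \<not> (\<exists>t. defect \<iota> (q t z) = 0 \<and> defect \<kappa> (q t z) = 0)"
    if kj: "k \<in> \<Theta>" "j \<in> \<Theta>" "k \<noteq> j" and only: "only l k \<iota>" "only l j \<kappa>" for k j l \<iota> \<kappa>
  proof -
    \<comment> \<open>\<open>V\<close> generates the free motion and squares to zero, so the orbit
      of \<open>z\<close> is exactly \<open>z + t V z\<close>. The vector \<open>pos s\<close> moves
      only the position of particle \<open>l\<close>.\<close>
    define V where "V = (\<lambda>z :: ('a \<times> 'a) ^ 'n. \<chi> i. (snd (z $ i), 0 :: 'a))"
    define pos where "pos s = (\<chi> i. (if i = l then s else 0, 0 :: 'a))" for s :: 'a
    define \<alpha> where "\<alpha> \<iota> z = defect \<iota> (\<lambda>i. fst (z $ i))" for \<iota> and z :: "('a \<times> 'a) ^ 'n"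
    have lin: "linear (\<alpha> \<iota>)" for \<iota>
      by (rule linearI) (simp_all add: \<alpha>_def defect_add defect_scaleR)
    have \<alpha>V: "\<alpha> \<iota> (z + t *\<^sub>R V z) = defect \<iota> (q t z)" for \<iota> z t
      by (simp add: \<alpha>_def V_def q_def[abs_def])
    have \<alpha>pos: "\<alpha> \<iota> (pos s) = coef k * (k \<bullet> s)" if "only l k \<iota>" for \<iota> k s
      using that by (simp add: \<alpha>_def pos_def defect_single only_def)
    have "{k} \<subset> \<Theta>" "{j} \<subset> \<Theta>"
      using kj by auto
    from sum_coef_proper[OF this(1)] sum_coef_proper[OF this(2)]
    have nz: "coef k \<noteq> 0" "k \<noteq> 0" "coef j \<noteq> 0" "j \<noteq> 0"
      by auto
    \<comment> \<open>\<open>k - r\<close> is the component of \<open>k\<close> orthogonal to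
      \<open>j\<close>. Moving particle \<open>l\<close> along it changes the defect of \<iota> but
      not that of \<kappa>; a rescaling then gives the vector \<open>e\<close> of the flow
      lemma.\<close>
    define r where "r = (k \<bullet> j / (j \<bullet> j)) *\<^sub>R j"
    have "k - r \<noteq> 0"
    proof
      assume "k - r = 0"
      moreover have "independent {k, j}"
        using kj d2 by (intro indep) auto
      ultimately show False
        using kj(3) span_scale[OF span_base[of j "{j}"], of "k \<bullet> j / (j \<bullet> j)"]
        by (simp add: independent_insert r_def)
    qed
    have jr: "j \<bullet> (k - r) = 0"
      using nz by (simp add: r_def inner_diff_right inner_commute)
    then have kr: "k \<bullet> (k - r) = (k - r) \<bullet> (k - r)"
      by (simp add: inner_diff_left r_def)
    define s where "s = (1 / (coef k * (k \<bullet> (k - r)))) *\<^sub>R (k - r)"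
    have "negligible {z. \<exists>t. \<alpha> \<iota> (z + t *\<^sub>R V z) = 0 \<and> \<alpha> \<kappa> (z + t *\<^sub>R V z) = 0}"
    proof (rule negligible_flow_into_codim2[where e = "pos s" and g = "pos j"])
      show "linear V"
        by (rule linearI) (simp_all add: V_def vec_eq_iff)
      show "V (V z) = 0" for z
        by (simp add: V_def vec_eq_iff zero_prod_def)
      show "V (pos s) = 0"
        by (simp add: V_def pos_def vec_eq_iff zero_prod_def)
      show "\<alpha> \<iota> (pos s) = 1"
        using nz \<open>k - r \<noteq> 0\<close> by (simp add: \<alpha>pos[OF only(1)] s_def kr)
      show "\<alpha> \<kappa> (pos s) = 0"
        by (simp add: \<alpha>pos[OF only(2)] s_def jr)
      show "\<alpha> \<kappa> (pos j) \<noteq> 0"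
        using nz by (simp add: \<alpha>pos[OF only(2)])
    qed (fact lin)+
    from AE_lborel_negligible[OF this] show ?thesis
      by (simp add: \<alpha>V)
  qed
  define I where "I = {(k, j, l, \<iota>, \<kappa>). k \<in> \<Theta> \<and> j \<in> \<Theta> \<and> k \<noteq> j \<and> \<iota> \<in> mixed \<and> \<kappa> \<in> mixed \<and>
    only l k \<iota> \<and> only l j \<kappa>}"
  have "finite I"
  proof (rule finite_subset)
    show "I \<subseteq> \<Theta> \<times> \<Theta> \<times> UNIV \<times> mixed \<times> mixed"
      by (auto simp: I_def)
  qed (simp add: finite_dirs finite_mixed)
  then have "AE z in lborel. \<forall>(k, j, l, \<iota>, \<kappa>)\<in>I. \<not> (\<exists>t. defect \<iota> (q t z) = 0 \<and> defect \<kappa> (q t z) = 0)"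
  proof (rule AE_finite_allI)
    fix s assume "s \<in> I"
    then obtain k j l \<iota> \<kappa> where "s = (k, j, l, \<iota>, \<kappa>)" "k \<in> \<Theta>" "j \<in> \<Theta>" "k \<noteq> j" "only l k \<iota>" "only l j \<kappa>"
      unfolding I_def by blast
    then show "AE z in lborel. case s of (k, j, l, \<iota>, \<kappa>) \<Rightarrow>
        \<not> (\<exists>t. defect \<iota> (q t z) = 0 \<and> defect \<kappa> (q t z) = 0)"
      using key[of k j l \<iota> \<kappa>] by simp
  qed
  then show ?thesis
    unfolding q_def[symmetric] isolated_def
  proof (rule eventually_mono, intro allI)
    fix z t l
    assume z: "\<forall>(k, j, l, \<iota>, \<kappa>)\<in>I. \<not> (\<exists>t. defect \<iota> (q t z) = 0 \<and> defect \<kappa> (q t z) = 0)"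
    show "\<exists>k\<in>\<Theta>. \<forall>y. (\<forall>j\<in>\<Theta>. \<exists>i. j \<bullet> y = j \<bullet> q t z i) \<longrightarrow> k \<bullet> y = k \<bullet> q t z l \<longrightarrow> y = q t z l"
    proof (rule ccontr)
      assume contra: "\<not> ?thesis"
      \<comment> \<open>If no line through \<open>l\<close> avoids the ghost points, each direction
        \<open>k\<close> yields one. Its assignment takes the value \<open>l\<close> at
        \<open>k\<close> only, since two directions determine a point of the plane. Two different
        \<open>k\<close> then give two defects that vanish simultaneously.\<close>
      have *: "\<exists>\<iota>\<in>mixed. only l k \<iota> \<and> defect \<iota> (q t z) = 0" if k: "k \<in> \<Theta>" for k
      proof -
        obtain y where y: "\<And>j. j \<in> \<Theta> \<Longrightarrow> \<exists>i. j \<bullet> y = j \<bullet> q t z i" "k \<bullet> y = k \<bullet> q t z l" "y \<noteq> q t z l"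
          using contra k by blast
        obtain \<iota> where \<iota>: "\<iota> \<in> mixed" "\<iota> k = l" "\<And>j. j \<in> \<Theta> \<Longrightarrow> j \<bullet> y = j \<bullet> q t z (\<iota> j)"
          "defect \<iota> (q t z) = 0"
          using grid_index[OF y(1) k y(2,3)] by blast
        have "j = k" if "j \<in> \<Theta>" "\<iota> j = l" for j
        proof (rule ccontr)
          assume "j \<noteq> k"
          then have "y = q t z l"
            using k y(2) that \<iota>(3)[OF that(1)] d2 by (intro eq_by_projections[of "{k, j}"]) auto
          with y(3) show False ..
        qed
        then have "only l k \<iota>"
          unfolding only_def using \<iota>(2) k by blast
        with \<iota> show ?thesis by blast
      qed
      obtain k where k: "k \<in> \<Theta>"
        using dirs_ne by blast
      have "\<Theta> \<noteq> {k}"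
        using card_dirs d2 by auto
      then obtain j where j: "j \<in> \<Theta>" "k \<noteq> j"
        using k by blast
      from *[OF k] *[OF j(1)] j k z show False
        unfolding I_def by blast
    qed
  qed
qed

end

text \<open>The position at time \<open>t\<close> of a phase point on the line is its inner product
  with \<open>(1, t)\<close>, so three times act as three directions in the plane. Two such vectors
  share the first entry 1, hence are parallel only if equal.\<close>

lemma general_position_times:
  assumes "card T = 3"
  shows "general_position ((\<lambda>t. (1, t)) ` T :: (real \<times> real) set)"
proof
  have "inj_on (\<lambda>t. (1 :: real, t)) T"
    by (auto intro: inj_onI)
  then show "card ((\<lambda>t. (1, t)) ` T :: (real \<times> real) set) = DIM(real \<times> real) + 1"
    using assms by (simp add: card_image)
  show "finite ((\<lambda>t. (1, t)) ` T :: (real \<times> real) set)"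
    using assms by (simp add: card_ge_0_finite)
  fix K :: "(real \<times> real) set" assume K: "K \<subseteq> (\<lambda>t. (1, t)) ` T" and "card K = DIM(real \<times> real)"
  then have "card K = 2"
    by simp
  then obtain a b where ab: "K = {a, b}" "a \<noteq> b"
    unfolding card_2_iff by blast
  with K obtain s t where "a = (1, s)" "b = (1, t)"
    by blast
  with ab have "K = {(1, s), (1, t)}" "s \<noteq> t"
    by simp_all
  then show "independent K"
    by (auto simp: independent_insert span_singleton zero_prod_def)
qed

section \<open>Projections and motions of measures\<close>

text \<open>For a nonnegative measure every admissible partition gives the total mass, so the
  supremum is that of a constant.\<close>

lemma tv_norm_measure:
  assumes "finite_measure u" and "sets u = sets borel"
  shows "tv_norm (measure u) = measure u UNIV"
proof -
  have "(\<Sum>A\<in>P. \<bar>measure u A\<bar>) = measure u UNIV"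
    if P: "finite P" "P \<subseteq> sets borel" "partition_on UNIV P" for P
  proof -
    have "measure u (\<Union>A\<in>P. A) = (\<Sum>A\<in>P. measure u A)"
      using P assms(2)
      by (intro finite_measure.finite_measure_finite_Union[OF assms(1)])
        (auto simp: partition_on_def disjoint_def disjoint_family_on_def)
    then show ?thesis
      using P(3) by (simp add: partition_on_def)
  qed
  then have "(\<lambda>P. \<Sum>A\<in>P. \<bar>measure u A\<bar>) ` {P. finite P \<and> P \<subseteq> sets borel \<and> partition_on UNIV P}
      = (\<lambda>P. measure u UNIV) ` {P :: 'a set set. finite P \<and> P \<subseteq> sets borel \<and> partition_on UNIV P}"
    by (intro image_cong) auto
  moreover have "{UNIV} \<in> {P :: 'a set set. finite P \<and> P \<subseteq> sets borel \<and> partition_on UNIV P}"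
    by (auto simp: partition_on_def)
  then have "(SUP P\<in>{P :: 'a set set. finite P \<and> P \<subseteq> sets borel \<and> partition_on UNIV P}. measure u UNIV)
      = measure u UNIV"
    by (intro cSUP_const) blast
  ultimately show ?thesis
    unfolding tv_norm_def by (simp only:)
qed

lemma AE_uniform_count_measure:
  assumes "finite A"
  shows "(AE x in uniform_count_measure A. P x) \<longleftrightarrow> (\<forall>x\<in>A. P x)"
  using assms unfolding uniform_count_measure_def AE_point_measure by (auto simp: card_gt_0_iff)

section \<open>Measures carried by finitely many particles\<close>

lemma particles_sets [simp]: "sets (particles m z) = sets borel"
  by (simp add: particles_def)

lemma emeasure_particles_compl: "emeasure (particles m z) (- range (($) z)) = 0"
proof -
  have "- range (($) z) \<in> sets borel"
    by (simp add: finite_imp_closed borel_closed borel_comp)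
  then show ?thesis
    unfolding particles_def by (subst emeasure_distr) (auto simp: vimage_def)
qed

lemma distr_particles:
  assumes "g \<in> borel_measurable borel"
  shows "distr (particles m z) borel g = particles m (\<chi> i. g (z $ i))"
  unfolding particles_def using assms by (subst distr_distr) (auto simp: comp_def intro!: distr_cong)

lemma Mv_particles: "Mv t (particles m z) = particles m (\<chi> i. fst (z $ i) + t *\<^sub>R snd (z $ i))"
  unfolding Mv_def split_beta
  by (rule distr_particles) (intro borel_measurable_continuous_onI continuous_intros)

lemma Rj_particles: "Rj \<theta> (particles m z) = particles m (\<chi> i. (\<theta> \<bullet> fst (z $ i), \<theta> \<bullet> snd (z $ i)))"
  unfolding Rj_def split_beta
  by (rule distr_particles) (intro borel_measurable_continuous_onI continuous_intros)

lemma (in general_position) particles_eqI: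
  assumes "sets \<mu> = sets borel" "finite_measure \<mu>" and fin: "finite_measure (particles m z)"
    and "isolated (($) z)"
    and proj: "\<And>k. k \<in> \<Theta> \<Longrightarrow> distr \<mu> borel (\<lambda>y. k \<bullet> y) = distr (particles m z) borel (\<lambda>y. k \<bullet> y)"
  shows "\<mu> = particles m z"
proof (rule measure_eq_by_projections[where A = "range (($) z)" and K = \<Theta>])
  fix p assume "p \<in> range (($) z)"
  then obtain l where p: "p = z $ l"
    by blast
  obtain k where "k \<in> \<Theta>" and k: "\<And>y. \<forall>j\<in>\<Theta>. \<exists>i. j \<bullet> y = j \<bullet> z $ i \<Longrightarrow> k \<bullet> y = k \<bullet> z $ l \<Longrightarrow> y = z $ l"
    using \<open>isolated (($) z)\<close> unfolding isolated_def by metis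
  show "\<exists>k\<in>\<Theta>. \<forall>y. (\<forall>j\<in>\<Theta>. \<exists>a\<in>range (($) z). j \<bullet> y = j \<bullet> a) \<longrightarrow> k \<bullet> y = k \<bullet> p \<longrightarrow> y = p"
    unfolding p by (rule bexI[OF _ \<open>k \<in> \<Theta>\<close>]) (simp add: k)
qed (simp_all add: assms(1,2,5) fin emeasure_particles_compl finite_dirs dirs_ne)

section \<open>Mass and support under projections and motions\<close>

lemma measurable_Mv [measurable]:
  "(\<lambda>(x, v). x + t *\<^sub>R v) \<in> borel_measurable (borel :: ('a::euclidean_space \<times> 'a) measure)"
  unfolding split_beta by (intro borel_measurable_continuous_onI continuous_intros)

lemma measurable_Rj [measurable]:
  "(\<lambda>(x, v). (\<theta> \<bullet> x, \<theta> \<bullet> v)) \<in> borel_measurable (borel :: ('a::euclidean_space \<times> 'a) measure)"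
  unfolding split_beta by (intro borel_measurable_continuous_onI continuous_intros)

lemma emeasure_Mv_UNIV:
  assumes "sets \<mu> = sets borel"
  shows "emeasure (Mv t \<mu>) UNIV = emeasure \<mu> UNIV"
proof -
  note [measurable_cong] = assms
  show ?thesis
    unfolding Mv_def using sets_eq_imp_space_eq[OF assms] by (simp add: emeasure_distr)
qed

lemma emeasure_Rd_UNIV:
  assumes "sets \<mu> = sets borel"
  shows "emeasure (Rd \<theta> \<mu>) UNIV = emeasure \<mu> UNIV"
proof -
  note [measurable_cong] = assms
  show ?thesis
    unfolding Rd_def using sets_eq_imp_space_eq[OF assms] by (simp add: emeasure_distr)
qed

lemma emeasure_Rj_UNIV:
  assumes "sets \<mu> = sets borel"
  shows "emeasure (Rj \<theta> \<mu>) UNIV = emeasure \<mu> UNIV"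
proof -
  note [measurable_cong] = assms
  show ?thesis
    unfolding Rj_def using sets_eq_imp_space_eq[OF assms] by (simp add: emeasure_distr)
qed

text \<open>Both orders push \<mu> forward under the map from \<open>(x, v)\<close> to
  \<open>\<theta> \<bullet> x + t * (\<theta> \<bullet> v)\<close>. This is why the true phase space
  measure satisfies the coupling constraint.\<close>

lemma Mv_Rj:
  assumes "sets \<mu> = sets borel"
  shows "Mv t (Rj \<theta> \<mu>) = Rd \<theta> (Mv t \<mu>)"
proof -
  note [measurable_cong] = assms
  show ?thesis
    unfolding Mv_def Rj_def Rd_def
    using measurable_Mv[where 'a = real, of t]
    by (subst (1 2) distr_distr) (simp_all add: comp_def split_beta inner_add_right)
qed

lemma nonneg_measuresD:
  assumes "\<mu> \<in> nonneg_measures X"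
  shows "sets \<mu> = sets borel" "finite_measure \<mu>" "emeasure \<mu> (- X) = 0" "space \<mu> = UNIV"
  using assms sets_eq_imp_space_eq[of \<mu> borel] by (auto simp: nonneg_measures_def)

text \<open>For nonmeasurable \<open>Y\<close> the null set condition holds because \<open>emeasure\<close> is 0 there.\<close>

lemma nonneg_measures_distr:
  fixes g :: "'a::topological_space \<Rightarrow> 'b::topological_space"
  assumes \<mu>: "\<mu> \<in> nonneg_measures X" and "closed X" and g: "g \<in> borel_measurable borel"
    and "g ` X \<subseteq> Y"
  shows "distr \<mu> borel g \<in> nonneg_measures Y"
proof -
  note [measurable_cong] = nonneg_measuresD(1)[OF \<mu>]
  note [measurable] = g
  have "emeasure (distr \<mu> borel g) (- Y) = 0"
  proof (cases "- Y \<in> sets borel")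
    case True
    then have "emeasure (distr \<mu> borel g) (- Y) = emeasure \<mu> (g -` (- Y))"
      using nonneg_measuresD(4)[OF \<mu>] by (simp add: emeasure_distr)
    also have "\<dots> \<le> emeasure \<mu> (- X)"
      using assms nonneg_measuresD(1)[OF \<mu>] by (intro emeasure_mono) (auto simp: borel_closed borel_comp)
    finally show ?thesis
      using nonneg_measuresD(3)[OF \<mu>] by simp
  qed (simp add: emeasure_notin_sets)
  moreover have "finite_measure (distr \<mu> borel g)"
    by (rule finite_measure.finite_measure_distr[OF nonneg_measuresD(2)[OF \<mu>]]) measurable
  ultimately show ?thesis
    by (simp add: nonneg_measures_def)
qed

lemma closed_Lambda_set:
  assumes "closed \<Omega>"
  shows "closed (Lambda_set \<Omega> \<Sigma>)"
proof -
  have "Lambda_set \<Omega> \<Sigma> = (\<Inter>t\<in>\<Sigma>. (\<lambda>p. fst p + t *\<^sub>R snd p) -` \<Omega>)"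
    by (auto simp: Lambda_set_def)
  also have "closed \<dots>"
    using assms by (intro closed_INT ballI closed_vimage continuous_intros) auto
  finally show ?thesis .
qed

section \<open>The static and the dynamic problem\<close>

text \<open>The true \<gamma>, with slices \<open>Rj \<theta> \<mu>\<close>, written as a single
  pushforward of a product measure.\<close>

definition Rj_bundle :: "'a::euclidean_space set \<Rightarrow> ('a \<times> 'a) measure \<Rightarrow> ('a \<times> real \<times> real) measure" where
  "Rj_bundle \<Theta> \<mu> =
     distr (uniform_count_measure \<Theta> \<Otimes>\<^sub>M \<mu>) borel (\<lambda>(\<theta>, x, v). (\<theta>, \<theta> \<bullet> x, \<theta> \<bullet> v))"

section \<open>The feasible pair induced by a phase space measure\<close>

context
  fixes \<Theta> \<Omega> :: "'a::euclidean_space set" and \<Sigma> :: "real set" and \<mu> :: "('a \<times> 'a) measure"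
  assumes \<Theta>: "finite \<Theta>" "\<Theta> \<noteq> {}" and "closed \<Omega>" and \<mu>: "\<mu> \<in> nonneg_measures (Lambda_set \<Omega> \<Sigma>)"
begin

text \<open>The first factor carries the power set of \<Theta> instead of the Borel sets of the
  whole space, so continuity of the map does not settle the claim directly; measurability is
  assembled from the components.\<close>

lemma measurable_bundle:
  "(\<lambda>(\<theta>, x, v). (\<theta>, \<theta> \<bullet> x, \<theta> \<bullet> v)) \<in> borel_measurable (uniform_count_measure \<Theta> \<Otimes>\<^sub>M \<mu>)"
proof -
  have "(\<lambda>\<theta>. \<theta>) \<in> borel_measurable (uniform_count_measure \<Theta>)"
    unfolding uniform_count_measure_def measurable_point_measure_eq1 by simp
  from measurable_compose[OF measurable_fst this]
  have fst: "fst \<in> borel_measurable (uniform_count_measure \<Theta> \<Otimes>\<^sub>M \<mu>)" .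
  have "snd \<in> uniform_count_measure \<Theta> \<Otimes>\<^sub>M \<mu> \<rightarrow>\<^sub>M borel"
    using measurable_snd[of "uniform_count_measure \<Theta>" \<mu>]
    unfolding measurable_cong_sets[OF refl nonneg_measuresD(1)[OF \<mu>]] .
  note snd = measurable_compose[OF this]
  have cont: "fst \<in> borel_measurable (borel :: ('a \<times> 'a) measure)"
    "snd \<in> borel_measurable (borel :: ('a \<times> 'a) measure)"
    using measurable_fst[of "borel :: 'a measure" "borel :: 'a measure"]
      measurable_snd[of "borel :: 'a measure" "borel :: 'a measure"]
    unfolding borel_prod .
  show ?thesis
    unfolding split_beta
    using borel_measurable_Pair[OF fst borel_measurable_Pair[OF borel_measurable_inner[OF fst snd[OF cont(1)]]
      borel_measurable_inner[OF fst snd[OF cont(2)]]]] .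
qed

lemma emeasure_Rj_bundle:
  assumes "A \<in> sets borel" "B \<in> sets borel"
  shows "emeasure (Rj_bundle \<Theta> \<mu>) (A \<times> B) =
    (\<integral>\<^sup>+\<theta>. indicator A \<theta> * emeasure (Rj \<theta> \<mu>) B \<partial>uniform_count_measure \<Theta>)"
proof -
  note [measurable_cong] = nonneg_measuresD(1)[OF \<mu>]
  interpret \<mu>: finite_measure \<mu>
    by (rule nonneg_measuresD(2)[OF \<mu>])
  let ?N = "uniform_count_measure \<Theta> \<Otimes>\<^sub>M \<mu>"
  let ?g = "\<lambda>(\<theta> :: 'a, x :: 'a, v :: 'a). (\<theta>, \<theta> \<bullet> x, \<theta> \<bullet> v)"
  have AB: "A \<times> B \<in> sets borel"
    using pair_measureI[OF assms] unfolding borel_prod .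
  have "emeasure (Rj_bundle \<Theta> \<mu>) (A \<times> B) = emeasure ?N (?g -` (A \<times> B) \<inter> space ?N)"
    unfolding Rj_bundle_def by (rule emeasure_distr[OF measurable_bundle AB])
  also have "\<dots> = (\<integral>\<^sup>+\<theta>. emeasure \<mu> (Pair \<theta> -` (?g -` (A \<times> B) \<inter> space ?N)) \<partial>uniform_count_measure \<Theta>)"
    by (rule \<mu>.emeasure_pair_measure_alt[OF measurable_sets[OF measurable_bundle AB]])
  also have "\<dots> = (\<integral>\<^sup>+\<theta>. indicator A \<theta> * emeasure (Rj \<theta> \<mu>) B \<partial>uniform_count_measure \<Theta>)"
  proof (rule nn_integral_cong)
    fix \<theta> assume "\<theta> \<in> space (uniform_count_measure \<Theta>)"
    then have "Pair \<theta> -` (?g -` (A \<times> B) \<inter> space ?N) =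
        (if \<theta> \<in> A then (\<lambda>(x, v). (\<theta> \<bullet> x, \<theta> \<bullet> v)) -` B else {})"
      using nonneg_measuresD(4)[OF \<mu>] by (auto simp: space_pair_measure)
    then show "emeasure \<mu> (Pair \<theta> -` (?g -` (A \<times> B) \<inter> space ?N)) = indicator A \<theta> * emeasure (Rj \<theta> \<mu>) B"
      using nonneg_measuresD(4)[OF \<mu>] assms(2) by (simp add: Rj_def emeasure_distr)
  qed
  finally show ?thesis .
qed

lemma Rj_in_nonneg_measures:
  assumes "\<theta> \<in> \<Theta>"
  shows "Rj \<theta> \<mu> \<in> nonneg_measures (Gamma_set \<Theta> \<Omega> \<Sigma>)"
proof -
  have "(\<lambda>(x, v). (\<theta> \<bullet> x, \<theta> \<bullet> v)) ` Lambda_set \<Omega> \<Sigma> \<subseteq> Gamma_set \<Theta> \<Omega> \<Sigma>"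
    unfolding Gamma_set_def using assms by clarsimp blast
  from nonneg_measures_distr[OF \<mu> closed_Lambda_set[OF \<open>closed \<Omega>\<close>] measurable_Rj this]
  show ?thesis
    unfolding Rj_def .
qed

lemma Mv_in_nonneg_measures:
  assumes "t \<in> \<Sigma>"
  shows "Mv t \<mu> \<in> nonneg_measures \<Omega>"
proof -
  have "(\<lambda>(x, v). x + t *\<^sub>R v) ` Lambda_set \<Omega> \<Sigma> \<subseteq> \<Omega>"
    unfolding Lambda_set_def using assms by clarsimp
  from nonneg_measures_distr[OF \<mu> closed_Lambda_set[OF \<open>closed \<Omega>\<close>] measurable_Mv this]
  show ?thesis
    unfolding Mv_def .
qed

lemma emeasure_Rj_bundle_UNIV: "emeasure (Rj_bundle \<Theta> \<mu>) UNIV = emeasure \<mu> UNIV"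
proof -
  interpret prob_space "uniform_count_measure \<Theta>"
    by (rule prob_space_uniform_count_measure[OF \<Theta>])
  have "emeasure (Rj_bundle \<Theta> \<mu>) (UNIV \<times> UNIV) = (\<integral>\<^sup>+\<theta>. emeasure \<mu> UNIV \<partial>uniform_count_measure \<Theta>)"
    by (subst emeasure_Rj_bundle) (simp_all add: emeasure_Rj_UNIV[OF nonneg_measuresD(1)[OF \<mu>]])
  then show ?thesis
    using emeasure_space_1 by simp
qed

lemma Rj_bundle_in_nonneg_measures:
  "Rj_bundle \<Theta> \<mu> \<in> nonneg_measures (\<Theta> \<times> Gamma_set \<Theta> \<Omega> \<Sigma>)"
proof -
  interpret \<mu>: finite_measure \<mu>
    by (rule nonneg_measuresD(2)[OF \<mu>])
  let ?N = "uniform_count_measure \<Theta> \<Otimes>\<^sub>M \<mu>"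
  let ?g = "\<lambda>(\<theta> :: 'a, x :: 'a, v :: 'a). (\<theta>, \<theta> \<bullet> x, \<theta> \<bullet> v)"
  let ?Y = "- (\<Theta> \<times> Gamma_set \<Theta> \<Omega> \<Sigma>)"
  have L: "- Lambda_set \<Omega> \<Sigma> \<in> sets \<mu>"
    using closed_Lambda_set[OF \<open>closed \<Omega>\<close>] nonneg_measuresD(1)[OF \<mu>] by (simp add: borel_closed borel_comp)
  have "emeasure (Rj_bundle \<Theta> \<mu>) ?Y = 0"
  \<comment> \<open>For a set that is not Borel \<open>emeasure\<close> has the default value
    0.\<close>
  proof (cases "?Y \<in> sets borel")
    case True
    have "emeasure (Rj_bundle \<Theta> \<mu>) ?Y = emeasure ?N (?g -` ?Y \<inter> space ?N)"
      unfolding Rj_bundle_def by (rule emeasure_distr[OF measurable_bundle True])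
    also have "\<dots> \<le> emeasure ?N (\<Theta> \<times> - Lambda_set \<Omega> \<Sigma>)"
      using L by (intro emeasure_mono pair_measureI)
        (auto simp: space_pair_measure space_uniform_count_measure sets_uniform_count_measure Gamma_set_def)
    also have "\<dots> = 0"
      using L nonneg_measuresD(3)[OF \<mu>]
      by (subst \<mu>.emeasure_pair_measure_Times) (auto simp: sets_uniform_count_measure)
    finally show ?thesis
      by simp
  qed (simp add: emeasure_notin_sets Rj_bundle_def)
  moreover have "finite_measure (Rj_bundle \<Theta> \<mu>)"
    by (rule finite_measureI)
      (use emeasure_Rj_bundle_UNIV \<mu>.emeasure_finite[of UNIV] in \<open>simp add: Rj_bundle_def\<close>)
  ultimately show ?thesis
    by (simp add: nonneg_measures_def Rj_bundle_def)
qed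

lemma is_disintegration_Rj_bundle:
  "is_disintegration \<Theta> (Gamma_set \<Theta> \<Omega> \<Sigma>) (Rj_bundle \<Theta> \<mu>) (\<lambda>\<theta>. Rj \<theta> \<mu>)"
  unfolding is_disintegration_def
  by (intro conjI ballI Rj_in_nonneg_measures emeasure_Rj_bundle)

lemma feasible_Rj_bundle:
  assumes "T \<subseteq> \<Sigma>"
  shows "feasible \<Omega> \<Sigma> T \<Theta> Ob (\<lambda>t. Ob t (measure (Mv t \<mu>))) (\<lambda>t. Mv t \<mu>, Rj_bundle \<Theta> \<mu>)"
proof -
  have "\<forall>t\<in>\<Sigma>. AE \<theta> in uniform_count_measure \<Theta>. Mv t (Rj \<theta> \<mu>) = Rd \<theta> (Mv t \<mu>)"
    by (simp add: Mv_Rj[OF nonneg_measuresD(1)[OF \<mu>]])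
  with is_disintegration_Rj_bundle Rj_bundle_in_nonneg_measures show ?thesis
    unfolding feasible_def prod.case by (auto intro: Mv_in_nonneg_measures)
qed

text \<open>Motions and projections preserve total mass, so every slice has the mass of
  \<open>u t\<close>; averaging over the normalized counting measure keeps it. The dynamic objective
  thus equals the static objective at each time of \<Sigma>.\<close>

lemma tv_norm_feasible:
  assumes "feasible \<Omega> \<Sigma> T \<Theta> Ob f (u, \<gamma>)" and t: "t \<in> \<Sigma>"
  shows "tv_norm (measure \<gamma>) = tv_norm (measure (u t))"
proof -
  obtain \<gamma>s where u: "u t \<in> nonneg_measures \<Omega>" and \<gamma>: "\<gamma> \<in> nonneg_measures (\<Theta> \<times> Gamma_set \<Theta> \<Omega> \<Sigma>)"
    and dis: "is_disintegration \<Theta> (Gamma_set \<Theta> \<Omega> \<Sigma>) \<gamma> \<gamma>s"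
    and Mv: "\<And>\<theta>. \<theta> \<in> \<Theta> \<Longrightarrow> Mv t (\<gamma>s \<theta>) = Rd \<theta> (u t)"
    using assms by (auto simp: feasible_def AE_uniform_count_measure[OF \<Theta>(1)])
  interpret prob_space "uniform_count_measure \<Theta>"
    by (rule prob_space_uniform_count_measure[OF \<Theta>])
  have slice: "emeasure (\<gamma>s \<theta>) UNIV = emeasure (u t) UNIV" if "\<theta> \<in> \<Theta>" for \<theta>
  proof -
    have "\<gamma>s \<theta> \<in> nonneg_measures (Gamma_set \<Theta> \<Omega> \<Sigma>)"
      using dis that by (auto simp: is_disintegration_def)
    from emeasure_Mv_UNIV[OF nonneg_measuresD(1)[OF this], of t] show ?thesis
      using Mv[OF that] emeasure_Rd_UNIV[OF nonneg_measuresD(1)[OF u], of \<theta>] by simp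
  qed
  have "emeasure \<gamma> (A \<times> B) =
      (\<integral>\<^sup>+\<theta>. indicator A \<theta> * emeasure (\<gamma>s \<theta>) B \<partial>uniform_count_measure \<Theta>)"
    if "A \<in> sets borel" "B \<in> sets borel" for A B
    using dis that unfolding is_disintegration_def by blast
  from this[of UNIV UNIV]
  have "emeasure \<gamma> UNIV = (\<integral>\<^sup>+\<theta>. indicator UNIV \<theta> * emeasure (\<gamma>s \<theta>) UNIV \<partial>uniform_count_measure \<Theta>)"
    by simp
  also have "\<dots> = (\<integral>\<^sup>+\<theta>. emeasure (u t) UNIV \<partial>uniform_count_measure \<Theta>)"
    by (rule nn_integral_cong) (simp add: space_uniform_count_measure slice)
  finally have "emeasure \<gamma> UNIV = emeasure (u t) UNIV"
    using emeasure_space_1 by simp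
  then show ?thesis
    using nonneg_measuresD(1,2)[OF u] nonneg_measuresD(1,2)[OF \<gamma>]
    by (simp add: tv_norm_measure measure_def)
qed

text \<open>A feasible pair is a static competitor at every observation time, with the same
  objective. One time at which the true frame is a static minimizer therefore makes the true pair
  optimal. Conversely, a frame of any optimal pair is no heavier than the true one, so it is itself
  a static minimizer wherever the true frame is.\<close>

lemma dynamic_solutions:
  assumes "T \<subseteq> \<Sigma>" and f: "\<And>t. f t = Ob t (measure (Mv t \<mu>))"
    and "t0 \<in> T" "static_solution \<Omega> (Ob t0) (f t0) (Mv t0 \<mu>)"
  shows "dynamic_solution \<Omega> \<Sigma> T \<Theta> Ob f (\<lambda>t. Mv t \<mu>) (Rj_bundle \<Theta> \<mu>)"
    and "dynamic_solution \<Omega> \<Sigma> T \<Theta> Ob f u \<gamma> \<Longrightarrow> t \<in> T \<Longrightarrow>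
      unique_static_solution \<Omega> (Ob t) (f t) (Mv t \<mu>) \<Longrightarrow> u t = Mv t \<mu>"
proof -
  have f': "f = (\<lambda>t. Ob t (measure (Mv t \<mu>)))"
    using f by blast
  have feas: "feasible \<Omega> \<Sigma> T \<Theta> Ob f (\<lambda>t. Mv t \<mu>, Rj_bundle \<Theta> \<mu>)"
    unfolding f' by (rule feasible_Rj_bundle[OF \<open>T \<subseteq> \<Sigma>\<close>])
  have norm: "tv_norm (measure (Rj_bundle \<Theta> \<mu>)) = tv_norm (measure (Mv t \<mu>))" if "t \<in> T" for t
    using tv_norm_feasible[OF feas] that \<open>T \<subseteq> \<Sigma>\<close> by blast
  have stat: "u t \<in> nonneg_measures \<Omega>" "Ob t (measure (u t)) = f t"
     "tv_norm (measure \<gamma>) = tv_norm (measure (u t))"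
    if "feasible \<Omega> \<Sigma> T \<Theta> Ob f (u, \<gamma>)" "t \<in> T" for u \<gamma> t
    using that \<open>T \<subseteq> \<Sigma>\<close> tv_norm_feasible[OF that(1)] by (auto simp: feasible_def)
  have "\<not> tv_norm (measure \<gamma>) < tv_norm (measure (Rj_bundle \<Theta> \<mu>))"
    if "feasible \<Omega> \<Sigma> T \<Theta> Ob f (u, \<gamma>)" for u \<gamma>
    using stat[OF that \<open>t0 \<in> T\<close>] norm[OF \<open>t0 \<in> T\<close>] assms(4)
    by (auto simp: static_solution_def is_arg_min_def)
  with feas show "dynamic_solution \<Omega> \<Sigma> T \<Theta> Ob f (\<lambda>t. Mv t \<mu>) (Rj_bundle \<Theta> \<mu>)"
    by (auto simp: dynamic_solution_def is_arg_min_def)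
  assume dyn: "dynamic_solution \<Omega> \<Sigma> T \<Theta> Ob f u \<gamma>" and t: "t \<in> T"
    and uniq: "unique_static_solution \<Omega> (Ob t) (f t) (Mv t \<mu>)"
  have fu: "feasible \<Omega> \<Sigma> T \<Theta> Ob f (u, \<gamma>)"
    and "\<not> tv_norm (measure (Rj_bundle \<Theta> \<mu>)) < tv_norm (measure \<gamma>)"
    using dyn feas by (auto simp: dynamic_solution_def is_arg_min_def)
  then have "tv_norm (measure (u t)) \<le> tv_norm (measure (Mv t \<mu>))"
    using norm[OF t] stat(3)[OF fu t] by simp
  moreover have "\<not> tv_norm (measure w) < tv_norm (measure (Mv t \<mu>))"
    if "w \<in> nonneg_measures \<Omega>" "Ob t (measure w) = f t" for w
    using uniq that unfolding unique_static_solution_def static_solution_def is_arg_min_def by blast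
  ultimately have "static_solution \<Omega> (Ob t) (f t) (u t)"
    using stat(1,2)[OF fu t] unfolding static_solution_def is_arg_min_def
    by (meson order_less_le_trans)
  with uniq show "u t = Mv t \<mu>"
    by (simp add: unique_static_solution_def)
qed

end

text \<open>Singletons \<open>{\<theta>}\<close> have positive mass
  \<open>1 / card \<Theta>\<close>, so testing with them isolates the slice. Feasibility provides
  just one disintegration, whereas the final statement speaks about all of them.\<close>

lemma disintegration_unique:
  assumes dis: "is_disintegration \<Theta> \<Gamma> \<gamma> \<gamma>s" "is_disintegration \<Theta> \<Gamma> \<gamma> \<gamma>s'"
    and \<Theta>: "finite \<Theta>" "\<theta> \<in> \<Theta>"
  shows "\<gamma>s \<theta> = \<gamma>s' \<theta>"
proof (rule measure_eqI)
  have slice: "emeasure \<gamma> ({\<theta>} \<times> B) = ennreal (1 / card \<Theta>) * emeasure (\<gamma>s \<theta>) B"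
    if "is_disintegration \<Theta> \<Gamma> \<gamma> \<gamma>s" "B \<in> sets borel" for \<gamma>s B
  proof -
    have "emeasure \<gamma> ({\<theta>} \<times> B) =
        (\<integral>\<^sup>+\<eta>. indicator {\<theta>} \<eta> * emeasure (\<gamma>s \<eta>) B \<partial>uniform_count_measure \<Theta>)"
      using that by (auto simp: is_disintegration_def)
    also have "\<dots> = (\<Sum>\<eta>\<in>\<Theta>. if \<eta> = \<theta> then ennreal (1 / card \<Theta>) * emeasure (\<gamma>s \<theta>) B else 0)"
      unfolding uniform_count_measure_def nn_integral_point_measure_finite[OF \<Theta>(1)]
      by (intro sum.cong) auto
    finally show ?thesis
      using \<Theta> by simp
  qed
  have sets: "sets (\<gamma>s \<theta>) = sets borel" "sets (\<gamma>s' \<theta>) = sets borel"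
    using dis \<Theta>(2) by (auto simp: is_disintegration_def nonneg_measures_def)
  then show "sets (\<gamma>s \<theta>) = sets (\<gamma>s' \<theta>)"
    by simp
  fix B assume "B \<in> sets (\<gamma>s \<theta>)"
  then have "ennreal (1 / card \<Theta>) * emeasure (\<gamma>s \<theta>) B = ennreal (1 / card \<Theta>) * emeasure (\<gamma>s' \<theta>) B"
    using slice[OF dis(1)] slice[OF dis(2)] sets by simp
  moreover have "0 < 1 / real (card \<Theta>)"
    using \<Theta> by (auto simp: card_gt_0_iff)
  ultimately show "emeasure (\<gamma>s \<theta>) B = emeasure (\<gamma>s' \<theta>) B"
    by (simp add: ennreal_mult_cancel_left)
qed

section \<open>Recovery for generic particles\<close>

text \<open>First use of the tomography result: in the phase plane, \<open>Mv t\<close> is the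
  projection along \<open>(1, t)\<close>, and three times provide the required three
  directions.\<close>

lemma slice_eq_Rj:
  assumes T: "card T = 3" and \<gamma>: "sets \<gamma> = sets borel" "finite_measure \<gamma>"
    and fin: "finite_measure (particles m z)"
    and iso: "general_position.isolated ((\<lambda>t. (1, t)) ` T) (\<lambda>i. (\<theta> \<bullet> fst (z $ i), \<theta> \<bullet> snd (z $ i)))"
    and Mv: "\<And>t. t \<in> T \<Longrightarrow> Mv t \<gamma> = Rd \<theta> (Mv t (particles m z))"
  shows "\<gamma> = Rj \<theta> (particles m z)"
proof -
  interpret general_position "(\<lambda>t. (1, t)) ` T :: (real \<times> real) set"
    by (rule general_position_times[OF T])
  define y where "y = (\<chi> i. (\<theta> \<bullet> fst (z $ i), \<theta> \<bullet> snd (z $ i)))"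
  have y: "Rj \<theta> (particles m z) = particles m y"
    unfolding y_def by (rule Rj_particles)
  have Mv_inner: "Mv t \<mu> = distr \<mu> borel (\<lambda>p. (1, t) \<bullet> p)" for t and \<mu> :: "(real \<times> real) measure"
    unfolding Mv_def by (rule arg_cong[of _ _ "distr \<mu> borel"]) auto
  have "finite_measure (Rj \<theta> (particles m z))"
    by (rule finite_measureI) (use finite_measure.emeasure_finite[OF fin] in
      \<open>simp add: emeasure_Rj_UNIV Rj_def[THEN arg_cong[of _ _ space]]\<close>)
  moreover have "(($) y) = (\<lambda>i. (\<theta> \<bullet> fst (z $ i), \<theta> \<bullet> snd (z $ i)))"
    by (simp add: y_def fun_eq_iff)
  moreover have "distr \<gamma> borel ((\<bullet>) k) = distr (particles m y) borel ((\<bullet>) k)"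
    if "k \<in> (\<lambda>t. (1, t)) ` T" for k
  proof -
    obtain t where t: "k = (1, t)" "t \<in> T"
      using \<open>k \<in> (\<lambda>t. (1, t)) ` T\<close> by blast
    have "Mv t \<gamma> = Mv t (particles m y)"
      unfolding Mv[OF t(2)] y[symmetric] by (rule Mv_Rj[symmetric]) simp
    then show ?thesis
      unfolding Mv_inner t(1) .
  qed
  ultimately have "\<gamma> = particles m y"
    using \<gamma> iso by (intro particles_eqI) (simp_all add: y)
  then show ?thesis
    by (simp add: y)
qed

text \<open>Second use of the tomography result: the atoms are the particle positions at time
  \<open>t\<close>, and the directions are those of \<Theta>.\<close>

lemma (in general_position) frame_eq_Mv:
  assumes u: "sets u = sets borel" "finite_measure u"
    and fin: "finite_measure (particles m z)"
    and iso: "isolated (\<lambda>i. fst (z $ i) + t *\<^sub>R snd (z $ i))"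
    and Rd: "\<And>\<theta>. \<theta> \<in> \<Theta> \<Longrightarrow> Rd \<theta> u = Rd \<theta> (Mv t (particles m z))"
  shows "u = Mv t (particles m z)"
proof -
  define y where "y = (\<chi> i. fst (z $ i) + t *\<^sub>R snd (z $ i))"
  have y: "Mv t (particles m z) = particles m y"
    unfolding y_def by (rule Mv_particles)
  have "finite_measure (Mv t (particles m z))"
    by (rule finite_measureI) (use finite_measure.emeasure_finite[OF fin] in
      \<open>simp add: emeasure_Mv_UNIV Mv_def[THEN arg_cong[of _ _ space]]\<close>)
  moreover have "(($) y) = (\<lambda>i. fst (z $ i) + t *\<^sub>R snd (z $ i))"
    by (simp add: y_def fun_eq_iff)
  ultimately have "u = particles m y"
    using u iso Rd by (intro particles_eqI) (simp_all add: y Rd_def)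
  then show ?thesis
    by (simp add: y)
qed

text \<open>For countably many times the null sets of \<open>AE_regular\<close> can be united. An
  uncountable \<open>S\<close> needs one null set for all times, which
  \<open>isolated_linear\<close> and \<open>AE_planar_isolated\<close> supply in dimensions one and
  two.\<close>

lemma (in general_position) AE_isolated:
  fixes S :: "real set"
  assumes "countable S \<or> DIM('a) \<le> 2"
  shows "AE z in lborel. \<forall>t\<in>S. isolated (\<lambda>i::'n::finite. fst (z $ i) + t *\<^sub>R snd (z $ i))"
proof -
  consider "countable S" | "DIM('a) = 1" | "DIM('a) = 2"
    using assms DIM_positive[where 'a = 'a] by linarith
  then show ?thesis
  proof cases
    case 1
    show ?thesis
    proof (rule AE_ball_countable'[OF _ 1])
      fix t
      have "linear (\<lambda>p :: 'a \<times> 'a. fst p + t *\<^sub>R snd p)"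
        by (rule linearI) (simp_all add: algebra_simps)
      moreover have "surj (\<lambda>p :: 'a \<times> 'a. fst p + t *\<^sub>R snd p)"
        by (rule surjI[of _ "\<lambda>x. (x, 0)"]) simp
      ultimately have "AE z in lborel. regular (\<lambda>i::'n. fst (z $ i) + t *\<^sub>R snd (z $ i))"
        by (rule AE_regular)
      then show "AE z in lborel. isolated (\<lambda>i::'n. fst (z $ i) + t *\<^sub>R snd (z $ i))"
        by (rule eventually_mono) (rule regular_imp_isolated)
    qed
  next
    case 2
    then show ?thesis
      by (simp add: isolated_linear)
  next
    case 3
    from AE_planar_isolated[OF this] show ?thesis
      by (rule eventually_mono) blast
  qed
qed

text \<open>Almost surely the velocities alone are regular, and then only finitely many times are
  irregular, whatever the initial positions.\<close>

lemma (in general_position) AE_finite_not_isolated: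
  "AE z in lborel. finite {t. \<not> isolated (\<lambda>i::'n::finite. fst (z $ i) + t *\<^sub>R snd (z $ i))}"
proof -
  have "linear (snd :: 'a \<times> 'a \<Rightarrow> 'a)" "surj (snd :: 'a \<times> 'a \<Rightarrow> 'a)"
    by (simp_all add: linear_snd)
  then have "AE z :: ('a \<times> 'a) ^ 'n in lborel. regular (\<lambda>i. snd (z $ i))"
    by (rule AE_regular)
  then show ?thesis
  proof (rule eventually_mono)
    fix z :: "('a \<times> 'a) ^ 'n"
    assume "regular (\<lambda>i. snd (z $ i))"
    from finite_irregular_times[OF this, of "\<lambda>i. fst (z $ i)"]
    show "finite {t. \<not> isolated (\<lambda>i. fst (z $ i) + t *\<^sub>R snd (z $ i))}"
      by (rule rev_finite_subset) (use regular_imp_isolated in blast)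
  qed
qed

text \<open>Since \<theta> is a unit vector, sending \<open>(a, b)\<close> to
  \<open>(a *\<^sub>R \<theta>, b *\<^sub>R \<theta>)\<close> is a right inverse of the projection
  to the phase plane, which makes \<open>AE_regular\<close> applicable.\<close>

lemma AE_isolated_phase:
  fixes \<theta> :: "'a::euclidean_space"
  assumes "card T = 3" and "norm \<theta> = 1"
  shows "AE z in lborel. general_position.isolated ((\<lambda>t. (1, t)) ` T)
    (\<lambda>i::'n::finite. (\<theta> \<bullet> fst (z $ i), \<theta> \<bullet> snd (z $ i)))"
proof -
  interpret general_position "(\<lambda>t. (1, t)) ` T :: (real \<times> real) set"
    by (rule general_position_times) fact
  have "\<theta> \<bullet> \<theta> = 1"
    using assms(2) by (simp add: dot_square_norm)
  then have "surj (\<lambda>p :: 'a \<times> 'a. (\<theta> \<bullet> fst p, \<theta> \<bullet> snd p))"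
    by (intro surjI[of _ "\<lambda>q. (fst q *\<^sub>R \<theta>, snd q *\<^sub>R \<theta>)"]) simp
  moreover have "linear (\<lambda>p :: 'a \<times> 'a. (\<theta> \<bullet> fst p, \<theta> \<bullet> snd p))"
    by (rule linearI) (simp_all add: inner_add_right)
  ultimately have "AE z in lborel. regular (\<lambda>i::'n. (\<theta> \<bullet> fst (z $ i), \<theta> \<bullet> snd (z $ i)))"
    by (intro AE_regular)
  then show ?thesis
    by (rule eventually_mono) (rule regular_imp_isolated)
qed

text \<open>\<open>S\<close> collects the times at which exact recovery is claimed;
  \<open>S = \<Sigma>\<close> is allowed in dimension at most two, or if \<Sigma> is countable. In
  dimension three, split the four directions two and two between two particles: the defects of this
  assignment and of the swapped one vanish at the same time. Two ghost points then have the same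
  projections as the two particles, and equal amounts of mass can be moved to them if they lie in
  \<Omega>. For general \<Sigma> the conclusion hence permits finitely many exceptional
  times.\<close>

theorem theorem4:
  fixes \<Omega> :: "(real ^ 'd) set" and \<Sigma> T S :: "real set" and \<Theta> :: "(real ^ 'd) set"
    and Ob :: "real \<Rightarrow> ((real ^ 'd) set \<Rightarrow> real) \<Rightarrow> 'h::{real_inner, complete_space}"
    and Ob_pre :: "real \<Rightarrow> 'h \<Rightarrow> (real ^ 'd) \<Rightarrow> real"
    and P :: "'w measure"
    and m :: "'w \<Rightarrow> 'n::finite \<Rightarrow> real"
    and z :: "'w \<Rightarrow> ((real ^ 'd) \<times> (real ^ 'd)) ^ 'n"
    and lam :: "'w \<Rightarrow> ((real ^ 'd) \<times> (real ^ 'd)) measure"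
    and ut :: "'w \<Rightarrow> real \<Rightarrow> (real ^ 'd) measure"
    and f :: "'w \<Rightarrow> real \<Rightarrow> 'h"
  assumes "compact \<Omega>" and "compact \<Sigma>" and "finite T" and "T \<noteq> {}" and "T \<subseteq> \<Sigma>"
    and Ob_pre: "\<And>t. t \<in> T \<Longrightarrow> bounded_linear_into_C \<Omega> (Ob_pre t)"
    and Ob: "\<And>t. t \<in> T \<Longrightarrow> is_dual_of \<Omega> (Ob t) (Ob_pre t)"
    and "\<Theta> \<subseteq> sphere 0 1" and "finite \<Theta>" and "card \<Theta> = CARD('d) + 1"
    and "\<And>K. K \<subseteq> \<Theta> \<Longrightarrow> card K = CARD('d) \<Longrightarrow> independent K"
    and "prob_space P"
    and m_meas: "\<And>i. (\<lambda>\<omega>. m \<omega> i) \<in> borel_measurable P"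
    and m_nonneg: "\<And>\<omega> i. \<omega> \<in> space P \<Longrightarrow> m \<omega> i \<ge> 0"
    and z_meas: "z \<in> borel_measurable P"
    and z_ac: "absolutely_continuous lborel (distr P borel z)"
    and lam_def: "\<And>\<omega>. lam \<omega> = particles (m \<omega>) (z \<omega>)"
    and lam_in: "\<And>\<omega>. \<omega> \<in> space P \<Longrightarrow> lam \<omega> \<in> nonneg_measures (Lambda_set \<Omega> \<Sigma>)"
    and ut_def: "\<And>\<omega> t. ut \<omega> t = Mv t (lam \<omega>)"
    and f_def: "\<And>\<omega> t. f \<omega> t = Ob t (measure (ut \<omega> t))"
    and S: "S \<subseteq> \<Sigma>" "countable S \<or> CARD('d) \<le> 2"
  shows "AE \<omega> in P.
    (\<exists>T3\<subseteq>T. card T3 = 3 \<and> (\<forall>t\<in>T3. unique_static_solution \<Omega> (Ob t) (f \<omega> t) (ut \<omega> t))) \<longrightarrow>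
    (\<exists>u \<gamma>. dynamic_solution \<Omega> \<Sigma> T \<Theta> Ob (f \<omega>) u \<gamma>) \<and>
    (\<forall>u \<gamma>. dynamic_solution \<Omega> \<Sigma> T \<Theta> Ob (f \<omega>) u \<gamma> \<longrightarrow>
       (\<forall>t\<in>S. u t = ut \<omega> t) \<and>
       finite {t\<in>\<Sigma>. u t \<noteq> ut \<omega> t} \<and>
       (\<forall>\<gamma>s. is_disintegration \<Theta> (Gamma_set \<Theta> \<Omega> \<Sigma>) \<gamma> \<gamma>s \<longrightarrow>
          (AE \<theta> in uniform_count_measure \<Theta>. \<gamma>s \<theta> = Rj \<theta> (lam \<omega>))))"
proof -
  note \<Theta> = \<open>\<Theta> \<subseteq> sphere 0 1\<close> \<open>finite \<Theta>\<close> \<open>card \<Theta> = CARD('d) + 1\<close>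
  interpret general_position \<Theta>
    using assms(9-11) by unfold_locales simp_all
  let ?triples = "{T3. T3 \<subseteq> T \<and> card T3 = 3}"
  let ?x = "\<lambda>z t i. fst (z $ i) + t *\<^sub>R snd (z $ i)"
  \<comment> \<open>The three good times may depend on \<omega>, so the null sets of all triples
    from the finite set \<open>T\<close> are removed beforehand.\<close>
  have "AE z in lborel. \<forall>T3\<in>?triples. \<forall>\<theta>\<in>\<Theta>. general_position.isolated ((\<lambda>t. (1, t)) ` T3)
      (\<lambda>i::'n. (\<theta> \<bullet> fst (z $ i), \<theta> \<bullet> snd (z $ i)))"
    using \<Theta>(1) \<open>finite T\<close> by (intro AE_finite_allI AE_isolated_phase \<Theta>(2)) auto
  moreover have "AE z in lborel. \<forall>t\<in>S. isolated (?x z t :: 'n \<Rightarrow> _)"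
    using S(2) by (intro AE_isolated) simp
  moreover note AE_finite_not_isolated[where 'n = 'n]
  ultimately have "AE z in lborel. (\<forall>T3\<in>?triples. \<forall>\<theta>\<in>\<Theta>. general_position.isolated ((\<lambda>t. (1, t)) ` T3)
      (\<lambda>i::'n. (\<theta> \<bullet> fst (z $ i), \<theta> \<bullet> snd (z $ i)))) \<and>
      (\<forall>t\<in>S. isolated (?x z t)) \<and> finite {t. \<not> isolated (?x z t)}"
    (is "AE z in lborel. ?generic z")
    by eventually_elim blast
  then have "AE z in distr P borel z. ?generic z"
    by (rule absolutely_continuous_AE[OF _ z_ac, rotated]) simp
  from AE_distrD[OF z_meas this] AE_space[of P] show ?thesis
  proof (eventually_elim, intro impI)
    fix \<omega> assume generic: "?generic (z \<omega>)" and "\<omega> \<in> space P"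
      and "\<exists>T3\<subseteq>T. card T3 = 3 \<and> (\<forall>t\<in>T3. unique_static_solution \<Omega> (Ob t) (f \<omega> t) (ut \<omega> t))"
    then obtain T3 where T3: "T3 \<subseteq> T" "card T3 = 3"
      and uniq: "\<And>t. t \<in> T3 \<Longrightarrow> unique_static_solution \<Omega> (Ob t) (f \<omega> t) (Mv t (lam \<omega>))"
      unfolding ut_def by blast
    have lam: "lam \<omega> \<in> nonneg_measures (Lambda_set \<Omega> \<Sigma>)"
      by (rule lam_in) fact
    have fin: "finite_measure (particles (m \<omega>) (z \<omega>))"
      using nonneg_measuresD(2)[OF lam] unfolding lam_def .
    have f: "f \<omega> t = Ob t (measure (Mv t (lam \<omega>)))" for t
      by (simp add: f_def ut_def)
    obtain t0 where "t0 \<in> T3"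
      using T3(2) by fastforce
    then have t0: "t0 \<in> T" "static_solution \<Omega> (Ob t0) (f \<omega> t0) (Mv t0 (lam \<omega>))"
      using T3(1) uniq[of t0] by (auto simp: unique_static_solution_def)
    note sols = dynamic_solutions[OF \<Theta>(2) dirs_ne compact_imp_closed[OF \<open>compact \<Omega>\<close>] lam \<open>T \<subseteq> \<Sigma>\<close>,
        of "f \<omega>" Ob, OF f t0]
    show "(\<exists>u \<gamma>. dynamic_solution \<Omega> \<Sigma> T \<Theta> Ob (f \<omega>) u \<gamma>) \<and>
      (\<forall>u \<gamma>. dynamic_solution \<Omega> \<Sigma> T \<Theta> Ob (f \<omega>) u \<gamma> \<longrightarrow>
       (\<forall>t\<in>S. u t = ut \<omega> t) \<and>
       finite {t\<in>\<Sigma>. u t \<noteq> ut \<omega> t} \<and>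
       (\<forall>\<gamma>s. is_disintegration \<Theta> (Gamma_set \<Theta> \<Omega> \<Sigma>) \<gamma> \<gamma>s \<longrightarrow>
          (AE \<theta> in uniform_count_measure \<Theta>. \<gamma>s \<theta> = Rj \<theta> (lam \<omega>))))"
    proof (rule conjI, intro exI, rule sols(1), intro allI impI)
      fix u \<gamma> assume dyn: "dynamic_solution \<Omega> \<Sigma> T \<Theta> Ob (f \<omega>) u \<gamma>"
      have u3: "u t = Mv t (lam \<omega>)" if "t \<in> T3" for t
        using sols(2)[OF dyn _ uniq[OF that]] that T3(1) by blast
      have feas: "feasible \<Omega> \<Sigma> T \<Theta> Ob (f \<omega>) (u, \<gamma>)"
        using dyn by (simp add: dynamic_solution_def is_arg_min_def)
      then obtain \<gamma>s where dis: "is_disintegration \<Theta> (Gamma_set \<Theta> \<Omega> \<Sigma>) \<gamma> \<gamma>s"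
        and Mv: "\<And>t \<theta>. t \<in> \<Sigma> \<Longrightarrow> \<theta> \<in> \<Theta> \<Longrightarrow> Mv t (\<gamma>s \<theta>) = Rd \<theta> (u t)"
        and u: "\<And>t. t \<in> \<Sigma> \<Longrightarrow> u t \<in> nonneg_measures \<Omega>"
        unfolding feasible_def prod.case AE_uniform_count_measure[OF \<Theta>(2)] by blast
      \<comment> \<open>The three good times alone identify the slices, which do not depend on
        time.\<close>
      have slices: "\<gamma>s \<theta> = Rj \<theta> (lam \<omega>)" if "\<theta> \<in> \<Theta>" for \<theta>
      proof -
        have "\<gamma>s \<theta> \<in> nonneg_measures (Gamma_set \<Theta> \<Omega> \<Sigma>)"
          using dis that unfolding is_disintegration_def by blast
        note nonneg_measuresD(1,2)[OF this]
        moreover have "general_position.isolated ((\<lambda>t. (1, t)) ` T3)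
            (\<lambda>i. (\<theta> \<bullet> fst (z \<omega> $ i), \<theta> \<bullet> snd (z \<omega> $ i)))"
          using generic T3 that by blast
        moreover have "Mv t (\<gamma>s \<theta>) = Rd \<theta> (Mv t (particles (m \<omega>) (z \<omega>)))" if "t \<in> T3" for t
          using Mv[of t \<theta>] u3[OF that] that T3(1) \<open>T \<subseteq> \<Sigma>\<close> \<open>\<theta> \<in> \<Theta>\<close> by (auto simp: lam_def)
        ultimately show ?thesis
          unfolding lam_def by (intro slice_eq_Rj[OF T3(2) _ _ fin])
      qed
      \<comment> \<open>The known slices now determine the projections of \<open>u t\<close> at
        every time in \<Sigma>, observed or not.\<close>
      have frames: "u t = ut \<omega> t" if t: "t \<in> \<Sigma>" and iso: "isolated (?x (z \<omega>) t)" for t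
      proof -
        have "Rd \<theta> (u t) = Rd \<theta> (Mv t (particles (m \<omega>) (z \<omega>)))" if "\<theta> \<in> \<Theta>" for \<theta>
          using Mv[OF t that] Mv_Rj[OF nonneg_measuresD(1)[OF lam], of t \<theta>]
          by (simp add: slices[OF that] lam_def)
        with frame_eq_Mv[OF nonneg_measuresD(1,2)[OF u[OF t]] fin iso] show ?thesis
          by (simp add: ut_def lam_def)
      qed
      have "\<forall>t\<in>S. u t = ut \<omega> t"
        using frames generic S(1) by blast
      moreover have "finite {t\<in>\<Sigma>. u t \<noteq> ut \<omega> t}"
      proof (rule finite_subset)
        show "{t\<in>\<Sigma>. u t \<noteq> ut \<omega> t} \<subseteq> {t. \<not> isolated (?x (z \<omega>) t)}"
          using frames by blast
      qed (use generic in blast)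
      moreover have "\<gamma>s' \<theta> = Rj \<theta> (lam \<omega>)"
        if "is_disintegration \<Theta> (Gamma_set \<Theta> \<Omega> \<Sigma>) \<gamma> \<gamma>s'" "\<theta> \<in> \<Theta>" for \<gamma>s' \<theta>
        using disintegration_unique[OF that(1) dis \<Theta>(2) that(2)] slices[OF that(2)] by simp
      ultimately show "(\<forall>t\<in>S. u t = ut \<omega> t) \<and> finite {t\<in>\<Sigma>. u t \<noteq> ut \<omega> t} \<and>
         (\<forall>\<gamma>s. is_disintegration \<Theta> (Gamma_set \<Theta> \<Omega> \<Sigma>) \<gamma> \<gamma>s \<longrightarrow>
          (AE \<theta> in uniform_count_measure \<Theta>. \<gamma>s \<theta> = Rj \<theta> (lam \<omega>)))"
        unfolding AE_uniform_count_measure[OF \<Theta>(2)] by blast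
    qed
  qed
qed

end
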